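(* Let $\omega$ be a non-quasianalytic weight function. Then $(\mathcal{S}_\omega(\mathbb{R}^N),\cdot)$, with pointwise multiplication, is a multiplication topological algebra; that is, $fg\in\mathcal{S}_\omega(\mathbb{R}^N)$ for all $f,g\in\mathcal{S}_\omega(\mathbb{R}^N)$, and the bilinear map $\mathcal{S}_\omega(\mathbb{R}^N)\times\mathcal{S}_\omega(\mathbb{R}^N)\to\mathcal{S}_\omega(\mathbb{R}^N)$, $(f,g)\mapsto fg$, is (jointly) continuous.
   Context: Weights. A non-quasianalytic weight function is a continuous increasing function $\omega:[0,\infty)\to[0,\infty)$ such that: ($\alpha$) there is $K\ge 1$ with $\omega(2t)\le K(1+\omega(t))$ for all $t\ge 0$; ($\beta$) $\int_1^\infty \frac{\omega(t)}{1+t^2}\,dt<\infty$; ($\gamma$) there are $a\in\mathbb{R}$, $b>0$ with $\omega(t)\ge a+b\log(1+t)$ for all $t\ge 0$; ($\delta$) $\varphi_\omega(t)=\omega(e^t)$ is convex. It is assumed (normalization) that $\omega$ vanishes on $[0,1]$. For $x\in\mathbb{R}^N$, $\omega(x):=\omega(|x|)$. The Young conjugate is $\varphi^*_\omega(s):=\sup_{t\ge 0}\{st-\varphi_\omega(t)\}$, $s\ge 0$ (the value $+\infty$ is allowed, with $\exp(-\infty)=0$). Space. $\mathcal{S}_\omega(\mathbb{R}^N)$ is the set of all $f\in L^1(\mathbb{R}^N)$ such that $f,\hat f\in C^\infty(\mathbb{R}^N)$ and $\|\exp(\lambda\omega)\partial^\alpha f\|_\infty<\infty$, $\|\exp(\lambda\omega)\partial^\alpha\hat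 f\|_\infty<\infty$ for all $\lambda>0$, $\alpha\in\mathbb{N}_0^N$ ($\hat f$ is the Fourier transform). It is a Fréchet space whose topology is generated by the norms $q_{m,n}(f):=\sup_{\alpha\in\mathbb{N}_0^N}\|\exp(n\omega)\partial^\alpha f\|_\infty\exp\left(-m\varphi^*_\omega\left(\frac{|\alpha|}{m}\right)\right)$, $m,n\in\mathbb{N}$ (these are finite on $\mathcal{S}_\omega(\mathbb{R}^N)$). *)

theory Defs
  imports "HOL-Analysis.Analysis"
begin

section \<open>Weight functions\<close>

text \<open>The normalization (vanishing on the unit interval) is kept as a separate predicate.
  Only the values of the weight on the half-line of nonnegative reals matter;
  "increasing" means nondecreasing, as it must in view of the normalization.\<close>

definition nonquasianalytic_weight :: "(real \<Rightarrow> real) \<Rightarrow> bool" where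
  "nonquasianalytic_weight \<omega> \<longleftrightarrow>
     continuous_on {0..} \<omega> \<and> mono_on {0..} \<omega> \<and> (\<forall>t\<ge>0. \<omega> t \<ge> 0) \<and>
     (\<exists>K\<ge>1. \<forall>t\<ge>0. \<omega> (2 * t) \<le> K * (1 + \<omega> t)) \<and>
     set_integrable lborel {1..} (\<lambda>t. \<omega> t / (1 + t\<^sup>2)) \<and>
     (\<exists>a. \<exists>b>0. \<forall>t\<ge>0. \<omega> t \<ge> a + b * ln (1 + t)) \<and>
     convex_on UNIV (\<lambda>t. \<omega> (exp t))"

definition normalized_weight :: "(real \<Rightarrow> real) \<Rightarrow> bool" where
  "normalized_weight \<omega> \<longleftrightarrow> (\<forall>t\<in>{0..1}. \<omega> t = 0)"

definition young_conjugate :: "(real \<Rightarrow> real) \<Rightarrow> real \<Rightarrow> ereal" where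
  "young_conjugate \<omega> s = (SUP t\<in>{0..}. ereal (s * t - \<omega> (exp t)))"

definition exp_ereal :: "ereal \<Rightarrow> ennreal" where
  "exp_ereal x = (if x = \<infinity> then \<infinity> else if x = - \<infinity> then 0 else ennreal (exp (real_of_ereal x)))"


section \<open>Partial derivatives, smoothness and the Fourier transform\<close>

definition partial_deriv :: "'n \<Rightarrow> (real^'n \<Rightarrow> complex) \<Rightarrow> real^'n \<Rightarrow> complex" where
  "partial_deriv i f x = vector_derivative (\<lambda>t. f (x + t *\<^sub>R axis i 1)) (at 0)"

definition iter_partial :: "'n list \<Rightarrow> (real^'n \<Rightarrow> complex) \<Rightarrow> real^'n \<Rightarrow> complex" where
  "iter_partial is f = foldr partial_deriv is f"

definition smooth :: "(real^'n \<Rightarrow> complex) \<Rightarrow> bool" where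
  "smooth f \<longleftrightarrow> (\<forall>is.
     continuous_on UNIV (iter_partial is f) \<and>
     (\<forall>i x. (\<lambda>t. iter_partial is f (x + t *\<^sub>R axis i 1)) differentiable (at 0)))"

text \<open>A multi-index is a function from the coordinates to the naturals. The order in which the
  partial derivatives are taken is left open, since by Schwarz's theorem it is irrelevant
  for smooth functions.\<close>

definition multi_deriv :: "('n \<Rightarrow> nat) \<Rightarrow> (real^'n \<Rightarrow> complex) \<Rightarrow> real^'n \<Rightarrow> complex" where
  "multi_deriv \<alpha> f = iter_partial (SOME is. \<forall>i. count_list is i = \<alpha> i) f"

definition multi_order :: "('n::finite \<Rightarrow> nat) \<Rightarrow> nat" where
  "multi_order \<alpha> = (\<Sum>i\<in>UNIV. \<alpha> i)"

definition fourier :: "(real^'n \<Rightarrow> complex) \<Rightarrow> real^'n \<Rightarrow> complex" where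
  "fourier f \<xi> = (LINT x|lborel. cis (- (x \<bullet> \<xi>)) * f x)"

text \<open>Only applied to continuous functions, for which it is the essential supremum norm.\<close>

definition sup_norm :: "(real^'n \<Rightarrow> complex) \<Rightarrow> ennreal" where
  "sup_norm f = (SUP x. ennreal (norm (f x)))"


section \<open>The space and its topology\<close>

definition weighted_deriv ::
  "(real \<Rightarrow> real) \<Rightarrow> real \<Rightarrow> ('n \<Rightarrow> nat) \<Rightarrow> (real^'n \<Rightarrow> complex) \<Rightarrow> real^'n \<Rightarrow> complex" where
  "weighted_deriv \<omega> \<mu> \<alpha> f x = exp (\<mu> * \<omega> (norm x)) *\<^sub>R multi_deriv \<alpha> f x"

definition S_omega :: "(real \<Rightarrow> real) \<Rightarrow> (real^'n \<Rightarrow> complex) set" where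
  "S_omega \<omega> = {f. integrable lborel f \<and> smooth f \<and> smooth (fourier f) \<and>
     (\<forall>\<mu>>0. \<forall>\<alpha>. sup_norm (weighted_deriv \<omega> \<mu> \<alpha> f) < \<infinity> \<and>
                 sup_norm (weighted_deriv \<omega> \<mu> \<alpha> (fourier f)) < \<infinity>)}"

text \<open>The norms take extended values, so that no finiteness is built into the definition.
  Since \<open>0 * \<infinity> = 0\<close> on both sides in type \<^typ>\<open>ennreal\<close>, indices with infinite Young conjugate
  do not contribute.\<close>

definition q_norm ::
  "(real \<Rightarrow> real) \<Rightarrow> nat \<Rightarrow> nat \<Rightarrow> (real^'n \<Rightarrow> complex) \<Rightarrow> ennreal" where
  "q_norm \<omega> m n f = (SUP \<alpha>. sup_norm (weighted_deriv \<omega> (real n) \<alpha> f) *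
     exp_ereal (- (ereal (real m) * young_conjugate \<omega> (real (multi_order \<alpha>) / real m))))"

definition S_omega_ball ::
  "(real \<Rightarrow> real) \<Rightarrow> nat \<Rightarrow> nat \<Rightarrow> (real^'n \<Rightarrow> complex) \<Rightarrow> real \<Rightarrow> (real^'n \<Rightarrow> complex) set" where
  "S_omega_ball \<omega> m n f r = {g \<in> S_omega \<omega>. q_norm \<omega> m n (\<lambda>x. g x - f x) < ennreal r}"

definition S_omega_topology :: "(real \<Rightarrow> real) \<Rightarrow> (real^'n \<Rightarrow> complex) topology" where
  "S_omega_topology \<omega> = topology_generated_by
     {S_omega_ball \<omega> m n f r | m n f r. m \<ge> 1 \<and> n \<ge> 1 \<and> f \<in> S_omega \<omega> \<and> r > 0}"

lemma iter_partial_zero: "iter_partial is (\<lambda>x. 0) = (\<lambda>x. 0)"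
  by (induction "is") (auto simp: iter_partial_def partial_deriv_def fun_eq_iff)

lemma q_norm_zero: "q_norm \<omega> m n (\<lambda>x. 0) = 0"
  by (simp add: q_norm_def sup_norm_def weighted_deriv_def multi_deriv_def iter_partial_zero)

lemma topspace_S_omega_topology: "topspace (S_omega_topology \<omega>) = S_omega \<omega>"
proof
  show "topspace (S_omega_topology \<omega>) \<subseteq> S_omega \<omega>"
    by (auto simp: S_omega_topology_def S_omega_ball_def)
  show "S_omega \<omega> \<subseteq> topspace (S_omega_topology \<omega>)"
  proof
    fix f :: "real^'n \<Rightarrow> complex" assume f: "f \<in> S_omega \<omega>"
    then have "f \<in> S_omega_ball \<omega> 1 1 f 1"
      by (simp add: S_omega_ball_def q_norm_zero)
    moreover have "\<exists>m n g r. S_omega_ball \<omega> 1 1 f 1 = S_omega_ball \<omega> m n g r \<and>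
        m \<ge> 1 \<and> n \<ge> 1 \<and> g \<in> S_omega \<omega> \<and> r > 0"
      using f by (intro exI[of _ 1] exI[of _ f]) auto
    ultimately show "f \<in> topspace (S_omega_topology \<omega>)"
      unfolding S_omega_topology_def topology_generated_by_topspace by blast
  qed
qed

end

theory Submission
  imports
    Defs
    "HOL-Probability.Probability"
    "HOL-Computational_Algebra.Polynomial"
    "HOL-Library.Multiset"
begin

text \<open>By the Leibniz rule and superadditivity of \<open>\<phi>\<^sup>*\<close>, for every \<open>m\<close> there is \<open>m'\<close> such that
  \<open>q\<^bsub>m,n\<^esub>(fg) \<le> C q\<^bsub>m',n\<^esub>(f) q\<^bsub>m',n\<^esub>(g)\<close>; the factor \<open>2 ^ |\<alpha>|\<close> from the binomial coefficients is absorbed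
  by passing from \<open>m\<close> to \<open>m'\<close> with condition \<open>(\<alpha>)\<close>. Joint continuity follows once the norms are known to be finite.

  For finiteness, Fourier inversion writes \<open>f\<close> as the transform of a function that decays like
  \<open>exp (- \<lambda> \<omega>)\<close> for all \<open>\<lambda>\<close>. This bounds \<open>|\<partial>\<^sup>\<alpha> f| exp (- m \<phi>\<^sup>*(|\<alpha>| / m))\<close> uniformly and makes mixed
  derivatives independent of their order. To gain the weight \<open>exp (n \<omega>)\<close>, one interpolates on the ray that
  leaves \<open>x\<close> in a coordinate direction pointing away from the origin, where \<open>\<omega>\<close> only increases: a
  Landau-Kolmogorov inequality \<open>|g\<^sup>(\<^sup>k\<^sup>)(0)|\<^sup>2 \<le> C\<^sup>k sup |g| sup |g\<^sup>(\<^sup>2\<^sup>k\<^sup>)|\<close> trades half of the (arbitrary) decay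
  of the function for the bound on its derivatives, one coordinate after the other.

  Closure under products uses that the transform of \<open>fg\<close> is a convolution of the transforms.\<close>

section \<open>An interpolation inequality on the half-line\<close>

text \<open>Membership in the space bounds every derivative separately, with constants that may
  depend on \<alpha>, whereas a norm asks for one constant for all \<alpha>. Decay of the transform
  gives such uniformity, since
  \<open>r ^ k * young_weight \<omega> m k \<le> exp (m * \<omega> r)\<close> controls the monomials
  of all degrees at once; but it gives no decay of the derivatives in x. The interpolation that
  supplies this decay may cost only a factor geometric in the order, because the change of m absorbs
  \<open>c ^ k\<close> but not a factorial. Equidistant nodes suffice for such a constant: the
  factorials in the Lagrange denominators and in Taylor's formula cancel up to geometric factors, by
  \<open>n ^ n \<le> 3 ^ n * fact n\<close> and \<open>(fact k)\<^sup>2 \<le> fact (2 * k)\<close>.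
  A half-line is forced by the weight, since a full line through x may come closer to the origin
  than x. Interpolation with order 2k fits the Young weights without loss, as squaring a weight just
  doubles both of its parameters.\<close>

text \<open>The coefficients are, up to sign, the elementary symmetric functions of the nodes, so
  expanding the product on the right exhibits the left side as one of its nonnegative terms.\<close>

lemma coeff_prod_linear_bound:
  fixes r :: real and S :: "nat set"
  assumes "finite S" "r \<ge> 0"
  shows "\<bar>coeff (\<Prod>i\<in>S. [:- real i, 1:]) k\<bar> * r ^ k \<le> (\<Prod>i\<in>S. r + real i)"
  using assms(1)
proof (induction S arbitrary: k rule: finite_induct)
  case empty
  show ?case by (cases k) auto
next
  case (insert a S)
  let ?Q = "\<Prod>i\<in>S. [:- real i, 1:]" and ?P = "\<Prod>i\<in>S. r + real i"
  show ?case
  proof (cases k)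
    case 0
    have "\<bar>coeff ?Q 0\<bar> * r ^ 0 \<le> ?P" by (rule insert.IH)
    moreover have "0 \<le> ?P" using assms by (intro prod_nonneg) auto
    ultimately have "real a * \<bar>coeff ?Q 0\<bar> \<le> (r + real a) * ?P"
      using assms by (intro mult_mono) auto
    then show ?thesis using 0 insert.hyps by (simp add: abs_mult)
  next
    case (Suc l)
    have "\<bar>coeff ([:- real a, 1:] * ?Q) k\<bar> * r ^ k
        = \<bar>coeff ?Q l - real a * coeff ?Q k\<bar> * r ^ k" by (simp add: Suc)
    also have "\<dots> \<le> (\<bar>coeff ?Q l\<bar> + real a * \<bar>coeff ?Q k\<bar>) * r ^ k"
      using assms abs_triangle_ineq4[of "coeff ?Q l" "real a * coeff ?Q k"]
      by (intro mult_right_mono) (auto simp: abs_mult)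
    also have "\<dots> = r * (\<bar>coeff ?Q l\<bar> * r ^ l) + real a * (\<bar>coeff ?Q k\<bar> * r ^ k)"
      by (simp add: Suc algebra_simps)
    also have "\<dots> \<le> r * ?P + real a * ?P"
      using assms insert.IH by (intro add_mono mult_left_mono) auto
    finally show ?thesis using insert.hyps by (simp add: algebra_simps)
  qed
qed

lemma lagrange_interpolation:
  fixes p :: "real poly"
  assumes "degree p < n"
  shows "p = (\<Sum>j<n. smult (poly p (real j) / (\<Prod>i\<in>{..<n}-{j}. real j - real i))
                  (\<Prod>i\<in>{..<n}-{j}. [:- real i, 1:]))" (is "p = ?q")
proof (rule poly_eqI_degree[of "real ` {..<n}"])
  have deg: "degree (\<Prod>i\<in>{..<n}-{j}. [:- real i, 1:]) \<le> n - 1" if "j < n" for j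
    using that degree_prod_sum_le[of "{..<n}-{j}" "\<lambda>i. [:- real i, 1:]"] by simp
  have "degree ?q \<le> n - 1"
    using deg by (intro degree_sum_le) (auto intro: order.trans[OF degree_smult_le])
  moreover have "card (real ` {..<n}) = n"
    by (subst card_image) (auto intro: inj_onI)
  ultimately show "card (real ` {..<n}) > degree ?q" "card (real ` {..<n}) > degree p"
    using assms by auto
next
  fix x :: real assume "x \<in> real ` {..<n}"
  then obtain l where l: "l < n" "x = real l" by auto
  have *: "poly (smult (poly p (real j) / (\<Prod>i\<in>{..<n}-{j}. real j - real i))
                  (\<Prod>i\<in>{..<n}-{j}. [:- real i, 1:])) (real l) = (if j = l then poly p (real l) else 0)"
    if "j < n" for j
    using that l by (auto simp: poly_prod)
  show "poly p x = poly ?q x"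
  proof -
    have "poly ?q x = (\<Sum>j<n. if j = l then poly p (real l) else 0)"
      unfolding poly_sum l(2) by (intro sum.cong refl *) auto
    then show ?thesis using l by simp
  qed
qed

text \<open>The nodes below j contribute \<open>fact j\<close>, those above it the other
  factorial.\<close>

lemma prod_diff_nodes:
  assumes "j < n"
  shows "\<bar>\<Prod>i\<in>{..<n}-{j}. real j - real i\<bar> = fact j * fact (n - 1 - j)"
proof -
  have split: "{..<n} - {j} = {..<j} \<union> {Suc j..<n}" using assms by auto
  have 1: "(\<Prod>i\<in>{..<j}. \<bar>real j - real i\<bar>) = fact j"
    unfolding fact_prod of_nat_prod
    by (rule prod.reindex_bij_witness[of _ "\<lambda>i. j - i" "\<lambda>i. j - i"]) (auto simp: of_nat_diff)
  have 2: "(\<Prod>i\<in>{Suc j..<n}. \<bar>real j - real i\<bar>) = fact (n - 1 - j)"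
    unfolding fact_prod of_nat_prod
    by (rule prod.reindex_bij_witness[of _ "\<lambda>i. j + i" "\<lambda>i. i - j"]) (auto simp: of_nat_diff)
  have "(\<Prod>i\<in>{..<j} \<union> {Suc j..<n}. \<bar>real j - real i\<bar>)
      = (\<Prod>i\<in>{..<j}. \<bar>real j - real i\<bar>) * (\<Prod>i\<in>{Suc j..<n}. \<bar>real j - real i\<bar>)"
    by (rule prod.union_disjoint) auto
  then show ?thesis unfolding abs_prod split 1 2 .
qed

text \<open>A single term of the exponential series at n is at most \<open>exp n\<close>, and
  \<open>exp 1 \<le> 3\<close>.\<close>

lemma power_self_le_fact: "real n ^ n \<le> 3 ^ n * fact n"
proof -
  have "real n ^ n / fact n \<le> (\<Sum>k\<in>{n}. (real n ^ k) / fact k)" by simp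
  also have "\<dots> \<le> (\<Sum>k. real n ^ k / fact k)"
    using summable_exp[of "real n"] by (intro sum_le_suminf) (auto simp: field_simps)
  also have "\<dots> = exp (real n)" by (simp add: exp_def scaleR_conv_of_real field_simps)
  also have "\<dots> = exp 1 ^ n" by (simp add: exp_of_nat_mult[symmetric])
  also have "\<dots> \<le> 3 ^ n" using exp_le by (intro power_mono) auto
  finally show ?thesis by (simp add: field_simps)
qed

text \<open>Each Lagrange summand, after multiplication by \<open>n ^ k\<close>, has a numerator of
  at most \<open>(2 * n) ^ (n - 1) * M\<close> over a denominator of at least
  \<open>fact (n - 1) / 2 ^ (n - 1)\<close>, hence is at most \<open>12 ^ n * M\<close>. The number
  n of summands is at most \<open>2 ^ n\<close>, which gives 24.\<close>

lemma coeff_le_bound_on_nodes: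
  fixes p :: "real poly"
  assumes "degree p < n" and M: "\<And>j. j < n \<Longrightarrow> \<bar>poly p (real j)\<bar> \<le> M"
  shows "\<bar>coeff p k\<bar> * real n ^ k \<le> 24 ^ n * M"
proof -
  have n: "n \<ge> 1" using assms by auto
  have M0: "M \<ge> 0" using M[of 0] n by auto
  let ?Q = "\<lambda>j. \<Prod>i\<in>{..<n}-{j}. [:- real i, 1:]"
  let ?D = "\<lambda>j. \<Prod>i\<in>{..<n}-{j}. real j - real i"
  have summand: "\<bar>poly p (real j) / ?D j * coeff (?Q j) k\<bar> * real n ^ k \<le> 12 ^ n * M" if j: "j < n" for j
  proof -
    have "(\<Prod>i\<in>{..<n}-{j}. real n + real i) \<le> (\<Prod>i\<in>{..<n}-{j}. 2 * real n)"
      by (intro prod_mono) auto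
    also have "\<dots> = (2 * real n) ^ (n - 1)" using j by simp
    finally have c: "\<bar>coeff (?Q j) k\<bar> * real n ^ k \<le> (2 * real n) ^ (n - 1)"
      using coeff_prod_linear_bound[of "{..<n}-{j}" "real n" k] by auto
    have "(fact (n - 1) :: real) = fact j * fact (n - 1 - j) * real ((n - 1) choose j)"
      using binomial_fact_lemma[of j "n - 1"] j
      by (metis (no_types, lifting) Suc_diff_1 Suc_leI fact_binomial less_Suc_eq_le binomial_fact_lemma mult.commute mult.left_commute n of_nat_fact of_nat_mult zero_less_one order_less_le_trans)
    also have "\<dots> \<le> fact j * fact (n - 1 - j) * 2 ^ (n - 1)"
    proof -
      have "(n-1) choose j \<le> 2 ^ (n - 1)" by (rule binomial_le_pow2)
      then have "real ((n-1) choose j) \<le> 2 ^ (n - 1)" by (metis of_nat_le_iff of_nat_numeral of_nat_power)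
      then show ?thesis by (intro mult_left_mono) auto
    qed
    finally have D: "fact (n - 1) \<le> \<bar>?D j\<bar> * 2 ^ (n - 1)"
      unfolding prod_diff_nodes[OF j] .
    have Dpos: "\<bar>?D j\<bar> > 0" unfolding prod_diff_nodes[OF j] by simp
    have "\<bar>poly p (real j) / ?D j * coeff (?Q j) k\<bar> * real n ^ k
       = \<bar>poly p (real j)\<bar> * (\<bar>coeff (?Q j) k\<bar> * real n ^ k) / \<bar>?D j\<bar>" by (simp add: abs_mult)
    also have "\<dots> \<le> M * (2 * real n) ^ (n - 1) / \<bar>?D j\<bar>"
      using M[OF j] c M0 Dpos by (intro divide_right_mono mult_mono) auto
    also have "\<dots> \<le> M * (12 ^ n * \<bar>?D j\<bar>) / \<bar>?D j\<bar>"
    proof (intro divide_right_mono mult_left_mono)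
      have "real n * real n ^ (n - 1) \<le> 3 ^ n * (real n * fact (n - 1))"
        using power_self_le_fact[of n] n by (cases n) (auto simp: algebra_simps)
      then have "real n ^ (n - 1) \<le> 3 ^ n * fact (n - 1)" using n by (simp add: mult.left_commute)
      also have "\<dots> \<le> 3 ^ n * (\<bar>?D j\<bar> * 2 ^ (n - 1))" using D by (intro mult_left_mono) auto
      finally have "2 ^ (n-1) * real n ^ (n - 1) \<le> 2 ^ (n-1) * (3 ^ n * (\<bar>?D j\<bar> * 2 ^ (n - 1)))"
        by (intro mult_left_mono) auto
      also have "\<dots> = (3 ^ n * (2 ^ (n - 1) * 2 ^ (n - 1))) * \<bar>?D j\<bar>" by (simp add: algebra_simps)
      also have "\<dots> \<le> 12 ^ n * \<bar>?D j\<bar>"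
      proof (rule mult_right_mono)
        have "(2::real) ^ (n - 1) * 2 ^ (n - 1) \<le> 2 ^ n * 2 ^ n"
          by (intro mult_mono power_increasing) auto
        also have "\<dots> = 4 ^ n" by (simp flip: power_mult_distrib)
        finally have "(3::real) ^ n * (2 ^ (n - 1) * 2 ^ (n - 1)) \<le> 3 ^ n * 4 ^ n" by simp
        then show "(3::real) ^ n * (2 ^ (n - 1) * 2 ^ (n - 1)) \<le> 12 ^ n"
          by (simp flip: power_mult_distrib)
      qed auto
      finally show "(2 * real n) ^ (n - 1) \<le> 12 ^ n * \<bar>?D j\<bar>" by (simp add: power_mult_distrib)
    qed (use M0 in auto)
    finally show ?thesis using Dpos by (simp add: mult.commute)
  qed
  have "coeff p k = (\<Sum>j<n. poly p (real j) / ?D j * coeff (?Q j) k)"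
    by (subst lagrange_interpolation[OF assms(1)]) (simp add: coeff_sum)
  then have "\<bar>coeff p k\<bar> \<le> (\<Sum>j<n. \<bar>poly p (real j) / ?D j * coeff (?Q j) k\<bar>)"
    by (simp only: sum_abs)
  then have "\<bar>coeff p k\<bar> * real n ^ k \<le> (\<Sum>j<n. \<bar>poly p (real j) / ?D j * coeff (?Q j) k\<bar>) * real n ^ k"
    by (rule mult_right_mono) simp
  also have "\<dots> \<le> (\<Sum>j<n. 12 ^ n * M)" unfolding sum_distrib_right
    by (intro sum_mono summand) auto
  also have "\<dots> = real n * 12 ^ n * M" by simp
  also have "\<dots> \<le> 2 ^ n * 12 ^ n * M"
    using of_nat_less_two_power[of n, where 'a=real] M0 by (intro mult_right_mono) auto
  finally show ?thesis by (simp flip: power_mult_distrib)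
qed

text \<open>Taylor's formula of order \<open>2 * k\<close> yields a polynomial bounded by
  \<open>A + B * H ^ (2 * k) / fact (2 * k)\<close> at equidistant points of \<open>[0, H]\<close>,
  and its coefficient of order k carries the derivative sought. Choosing H so that both terms
  balance turns the sum into a geometric mean.\<close>

lemma landau_kolmogorov_real:
  fixes D :: "nat \<Rightarrow> real \<Rightarrow> real"
  assumes D: "\<And>j t. t \<ge> 0 \<Longrightarrow> (D j has_real_derivative D (Suc j) t) (at t)"
    and A: "\<And>t. t \<ge> 0 \<Longrightarrow> \<bar>D 0 t\<bar> \<le> A" and B: "\<And>t. t \<ge> 0 \<Longrightarrow> \<bar>D (2 * k) t\<bar> \<le> B"
  shows "(D k 0)\<^sup>2 \<le> 4 * 576 ^ (2 * k) * A * B"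
proof (cases "k = 0")
  case True
  have "(D 0 0)\<^sup>2 = \<bar>D 0 0\<bar> * \<bar>D 0 0\<bar>" by (simp add: power2_eq_square)
  also have "\<dots> \<le> A * B" using A[of 0] B[of 0] True by (intro mult_mono) auto
  finally have "(D 0 0)\<^sup>2 \<le> A * B" .
  moreover from this have "0 \<le> A * B" by (rule order.trans[OF zero_le_power2])
  ultimately show ?thesis using True by simp
next
  case False
  define n where "n = 2 * k"
  have n: "n > 0" "k < n" using False by (auto simp: n_def)
  \<comment> \<open>The larger bounds A' and B' make room for strictly positive values, which the
    optimal H requires.\<close>
  have key: "\<bar>D k 0\<bar> * H ^ k / fact k \<le> 24 ^ n * (A' + B' * H ^ n / fact n)"
    if H: "H > 0" and A': "A \<le> A'" and B': "B \<le> B'" for H A' B'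
  proof -
    \<comment> \<open>With this spacing the points \<open>s * j\<close> with \<open>j < n\<close>
      stay in \<open>[0, H]\<close>; p is the Taylor polynomial rescaled so that they become integer
      nodes.\<close>
    define s where "s = H / real n"
    have s: "s > 0" using H n by (simp add: s_def)
    define p where "p = Poly (map (\<lambda>i. D i 0 / fact i * s ^ i) [0..<n])"
    have coeff: "coeff p i = (if i < n then D i 0 / fact i * s ^ i else 0)" for i
      by (simp add: p_def coeff_Poly_eq nth_default_def)
    have deg: "degree p < n"
    proof -
      have "degree p \<le> n - 1" by (rule degree_le) (use n in \<open>auto simp: coeff\<close>)
      then show ?thesis using n by auto
    qed
    have "\<bar>poly p (real j)\<bar> \<le> A' + B' * H ^ n / fact n" if j: "j < n" for j
    proof -
      have poly: "poly p (real j) = (\<Sum>m<n. D m 0 / fact m * (s * real j) ^ m)"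
      proof -
        have "poly p (real j) = (\<Sum>m<n. coeff p m * real j ^ m)"
          unfolding poly_altdef using deg
          by (intro sum.mono_neutral_left) (auto simp: coeff_eq_0)
        then show ?thesis by (simp add: coeff power_mult_distrib algebra_simps)
      qed
      show ?thesis
      proof (cases "j = 0")
        case True
        have "poly p (real j) = D 0 0" unfolding poly using n True by (simp add: power_0_left if_distrib sum.delta cong: if_cong)
        moreover have "0 \<le> B' * H ^ n / fact n" using B[of 0] B' H by (auto intro!: mult_nonneg_nonneg divide_nonneg_nonneg)
        ultimately show ?thesis using A[of 0] A' by auto
      next
        case False
        then have sj: "s * real j > 0" using s by simp
        have "\<exists>t. 0 < t \<and> t \<le> s * real j \<and> D 0 (s * real j) =
            (\<Sum>m<n. D m 0 / fact m * (s * real j) ^ m) + D n t / fact n * (s * real j) ^ n"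
          by (rule Maclaurin2[OF sj]) (use D in auto)
        then obtain t where t: "0 < t" "D 0 (s * real j) = poly p (real j) + D n t / fact n * (s * real j) ^ n"
          unfolding poly by auto
        have "\<bar>D n t / fact n * (s * real j) ^ n\<bar> \<le> B' / fact n * H ^ n"
        proof -
          have "s * real j \<le> H" using j s n by (simp add: s_def field_simps)
          then have "(s * real j) ^ n \<le> H ^ n" using sj by (intro power_mono) auto
          moreover have "\<bar>D n t\<bar> \<le> B'" using B[of t] B' t by (simp add: n_def)
          ultimately show ?thesis using sj
            unfolding abs_mult abs_divide by (intro mult_mono divide_mono) auto
        qed
        moreover have "\<bar>D 0 (s * real j)\<bar> \<le> A'" using A[of "s * real j"] sj A' by auto
        moreover have "B' / fact n * H ^ n = B' * H ^ n / fact n" by simp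
        ultimately show ?thesis using t(2) by linarith
      qed
    qed
    from coeff_le_bound_on_nodes[OF deg this, of k]
    have "\<bar>D k 0 / fact k * s ^ k\<bar> * real n ^ k \<le> 24 ^ n * (A' + B' * H ^ n / fact n)"
      using n by (simp add: coeff)
    moreover have "\<bar>D k 0 / fact k * s ^ k\<bar> * real n ^ k = \<bar>D k 0\<bar> * H ^ k / fact k"
      using H n s by (simp add: abs_mult s_def power_divide)
    ultimately show ?thesis by simp
  qed
  have A0: "A \<ge> 0" and B0: "B \<ge> 0" using A[of 0] B[of 0] by auto
  have *: "(D k 0)\<^sup>2 \<le> 4 * 576 ^ (2*k) * A' * B'" if "A' > A" "B' > B" for A' B'
  proof -
    \<comment> \<open>This H makes \<open>B' * H ^ n / fact n\<close> equal to A'. As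
      \<open>n = 2 * k\<close>, squaring the bound from \<open>key\<close> leaves H only in the
      power \<open>H ^ n\<close>, so the root disappears, and \<open>24 ^ n\<close> becomes
      \<open>576 ^ n\<close>.\<close>
    define H where "H = root n (fact n * A' / B')"
    have pos: "A' > 0" "B' > 0" using that A0 B0 by auto
    have H: "H > 0" using pos n by (simp add: H_def)
    have Hn: "H ^ n = fact n * A' / B'" using pos n by (simp add: H_def)
    have "\<bar>D k 0\<bar> * H ^ k / fact k \<le> 24 ^ n * (2 * A')"
      using key[OF H, of A' B'] that pos unfolding Hn by (simp add: field_simps)
    then have "(\<bar>D k 0\<bar> * H ^ k / fact k)\<^sup>2 \<le> (24 ^ n * (2 * A'))\<^sup>2"
      using H by (intro power_mono) auto
    moreover have "(\<bar>D k 0\<bar> * H ^ k / fact k)\<^sup>2 = (D k 0)\<^sup>2 * (fact n * A' / B') / (fact k)\<^sup>2"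
      unfolding Hn[symmetric] by (simp add: n_def power_divide power_mult_distrib power_even_eq)
    moreover have square: "(24 ^ n * (2 * A'))\<^sup>2 = 4 * 576 ^ n * A'\<^sup>2"
      by (simp add: power2_eq_square) (simp flip: power_mult_distrib)
    ultimately have 1: "(D k 0)\<^sup>2 * (fact n * A' / B') / (fact k)\<^sup>2 \<le> 4 * 576 ^ n * A'\<^sup>2"
      by (simp add: square)
    have "(fact k)\<^sup>2 \<le> (fact n :: real)"
    proof -
      have "fact k * fact k dvd (fact (k + k) :: nat)" by (rule fact_fact_dvd_fact)
      then have "fact k * fact k \<le> (fact (k + k) :: nat)" by (intro dvd_imp_le) auto
      then have "real (fact k * fact k) \<le> real (fact (k + k))" by (simp only: of_nat_le_iff)
      then show ?thesis by (simp add: n_def mult_2 power2_eq_square)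
    qed
    then have "(D k 0)\<^sup>2 * (A' / B') * 1 \<le> (D k 0)\<^sup>2 * (A' / B') * (fact n / (fact k)\<^sup>2)"
      using pos by (intro mult_left_mono) (auto simp: field_simps)
    with 1 have "(D k 0)\<^sup>2 * (A' / B') \<le> 4 * 576 ^ n * A'\<^sup>2" by (simp add: field_simps)
    then have "(D k 0)\<^sup>2 * A' \<le> (4 * 576 ^ n * A' * B') * A'"
      using pos by (simp add: field_simps power2_eq_square)
    then show ?thesis using pos(1) unfolding n_def by (rule mult_right_le_imp_le)
  qed
  \<comment> \<open>A or B may vanish, so the strict version is applied to \<open>A + e\<close> and
    \<open>B + e\<close>, and e tends to 0.\<close>
  show ?thesis
  proof (rule tendsto_le[of "at_right (0::real)"])
    show "((\<lambda>e. 4 * 576 ^ (2*k) * (A + e) * (B + e)) \<longlongrightarrow> 4 * 576 ^ (2*k) * A * B) (at_right 0)"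
      by (auto intro!: tendsto_eq_intros)
    show "((\<lambda>e. (D k 0)\<^sup>2) \<longlongrightarrow> (D k 0)\<^sup>2) (at_right (0::real))" by simp
    show "\<forall>\<^sub>F e in at_right 0. (D k 0)\<^sup>2 \<le> 4 * 576 ^ (2 * k) * (A + e) * (B + e)"
      unfolding eventually_at_right_field by (intro exI[of _ 1]) (auto intro!: *)
  qed simp
qed

text \<open>A unimodular constant c makes \<open>c * D k 0\<close> real and nonnegative. Taking the
  real part of \<open>c * D j t\<close> then loses nothing at order k, and at the orders 0 and 2k it
  is dominated by the norm.\<close>

lemma landau_kolmogorov:
  fixes D :: "nat \<Rightarrow> real \<Rightarrow> complex"
  assumes D: "\<And>j t. t \<ge> 0 \<Longrightarrow> (D j has_vector_derivative D (Suc j) t) (at t)"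
    and A: "\<And>t. t \<ge> 0 \<Longrightarrow> norm (D 0 t) \<le> A" and B: "\<And>t. t \<ge> 0 \<Longrightarrow> norm (D (2 * k) t) \<le> B"
  shows "(norm (D k 0))\<^sup>2 \<le> 4 * 576 ^ (2 * k) * A * B"
proof -
  define c where "c = (if D k 0 = 0 then 1 else cnj (D k 0) / norm (D k 0))"
  have c: "norm c = 1" by (simp add: c_def norm_divide)
  have ck: "Re (c * D k 0) = norm (D k 0)"
  proof (cases "D k 0 = 0")
    case False
    have "c * D k 0 = complex_of_real ((norm (D k 0))\<^sup>2) / norm (D k 0)"
      by (simp only: c_def False if_False complex_norm_square) simp
    also have "\<dots> = complex_of_real (norm (D k 0))"
      using False by (simp add: power2_eq_square)
    finally show ?thesis by simp
  qed simp
  have bd: "\<bar>Re (c * z)\<bar> \<le> norm z" for z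
    using abs_Re_le_cmod[of "c * z"] c by (simp add: norm_mult)
  have "(Re (c * D k 0))\<^sup>2 \<le> 4 * 576 ^ (2 * k) * A * B"
  proof (rule landau_kolmogorov_real[of "\<lambda>j t. Re (c * D j t)"])
    fix j and t :: real assume "t \<ge> 0"
    show "((\<lambda>t. Re (c * D j t)) has_real_derivative Re (c * D (Suc j) t)) (at t)"
      using bounded_linear.has_vector_derivative[OF bounded_linear_compose[OF bounded_linear_Re bounded_linear_mult_right] D[OF \<open>t \<ge> 0\<close>]]
      by (simp add: has_real_derivative_iff_has_vector_derivative o_def)
  qed (use A B bd order.trans in blast)+
  then show ?thesis unfolding ck .
qed

section \<open>The Young conjugate\<close>

text \<open>\<open>young_weight \<omega> m k\<close> is \<open>exp (- m \<phi>\<^sup>*(k / m))\<close>, see \<open>exp_ereal_young_conjugate\<close>; it is a real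
  number in all cases, being \<open>0\<close> where the Young conjugate is infinite.\<close>

definition young_weight :: "(real \<Rightarrow> real) \<Rightarrow> real \<Rightarrow> nat \<Rightarrow> real" where
  "young_weight \<omega> m k = (INF r\<in>{1..}. exp (m * \<omega> r) / r ^ k)"

lemma bdd_below_young: "bdd_below ((\<lambda>r. exp (m * \<omega> r) / r ^ k) ` {1::real..})"
  by (rule bdd_belowI[of _ 0]) auto

lemma young_weight_le:
  assumes "r \<ge> 1"
  shows "young_weight \<omega> m k \<le> exp (m * \<omega> r) / r ^ k"
  unfolding young_weight_def by (rule cINF_lower[OF bdd_below_young]) (use assms in auto)

lemma young_weight_greatest:
  assumes "\<And>r. r \<ge> 1 \<Longrightarrow> c \<le> exp (m * \<omega> r) / r ^ k"
  shows "c \<le> young_weight \<omega> m k"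
  unfolding young_weight_def by (rule cINF_greatest) (use assms in auto)

lemma young_weight_nonneg: "0 \<le> young_weight \<omega> m k"
  by (rule young_weight_greatest) auto

lemma young_weight_le_eps:
  assumes "\<epsilon> > 0"
  obtains r where "r \<ge> 1" "exp (m * \<omega> r) / r ^ k < young_weight \<omega> m k + \<epsilon>"
proof -
  have "\<exists>r\<in>{1..}. exp (m * \<omega> r) / r ^ k < young_weight \<omega> m k + \<epsilon>"
    unfolding young_weight_def using assms
    by (subst cINF_less_iff[OF _ bdd_below_young, symmetric]) auto
  then show ?thesis using that by auto
qed

text \<open>The substitution \<open>r = exp t\<close>, followed by the decreasing map
  \<open>exp (- m * _)\<close>, turns the supremum into the infimum. An infinite conjugate
  corresponds to the infimum 0.\<close>

lemma exp_ereal_young_conjugate: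
  assumes m: "m > 0"
  shows "exp_ereal (- (ereal m * young_conjugate \<omega> (real k / m))) = ennreal (young_weight \<omega> m k)"
proof -
  define y where "y = young_conjugate \<omega> (real k / m)"
  have upper: "ereal (real k / m * t - \<omega> (exp t)) \<le> y" if "t \<ge> 0" for t
    unfolding y_def young_conjugate_def by (rule SUP_upper) (use that in auto)
  have ln: "exp (m * \<omega> r) / r ^ k = exp (- (m * (real k / m * ln r - \<omega> (exp (ln r)))))"
    if "r \<ge> 1" for r
  proof -
    have "r ^ k = exp (real k * ln r)" using that by (simp add: exp_of_nat_mult)
    then show ?thesis using that m by (simp add: exp_diff[symmetric] right_diff_distrib exp_minus[symmetric])
  qed
  have "y \<noteq> -\<infinity>" using upper[of 0] by auto
  then consider "y = \<infinity>" | c where "y = ereal c" by (cases y) auto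
  then show ?thesis
  proof cases
    case 1
    have "young_weight \<omega> m k \<le> e" if e: "e > 0" for e
    proof -
      have "ereal (- ln e / m) < y" by (simp add: 1)
      then obtain t where t: "t \<ge> 0" "ereal (- ln e / m) < ereal (real k / m * t - \<omega> (exp t))"
        unfolding y_def young_conjugate_def less_SUP_iff by auto
      have "young_weight \<omega> m k \<le> exp (- (m * (real k / m * t - \<omega> (exp t))))"
        using young_weight_le[of "exp t" \<omega> m k] ln[of "exp t"] t by simp
      also have "\<dots> \<le> exp (ln e)"
      proof -
        define X where "X = real k / m * t - \<omega> (exp t)"
        have "- ln e / m < X" using t unfolding X_def by simp
        then have "- (m * X) \<le> ln e" using m by (simp add: pos_divide_less_eq[OF m] mult.commute[of m] del: divide_minus_left)
        then show ?thesis unfolding X_def by simp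
      qed
      finally show ?thesis using e by simp
    qed
    then have "young_weight \<omega> m k \<le> 0" by (rule field_le_epsilon) simp
    then have "young_weight \<omega> m k = 0" using young_weight_nonneg[of \<omega> m k] by simp
    then show ?thesis using m by (simp add: y_def[symmetric] 1 exp_ereal_def)
  next
    case 2
    have "young_weight \<omega> m k = exp (- (m * c))"
    proof (rule antisym)
      show "exp (- (m * c)) \<le> young_weight \<omega> m k"
      proof (rule young_weight_greatest)
        fix r :: real assume r: "r \<ge> 1"
        show "exp (- (m * c)) \<le> exp (m * \<omega> r) / r ^ k"
          unfolding ln[OF r] using upper[of "ln r"] r m unfolding 2 by (simp add: mult_left_mono)
      qed
      show "young_weight \<omega> m k \<le> exp (- (m * c))"
      proof (rule tendsto_lowerbound[of "\<lambda>e. exp (- (m * (c - e)))" _ "at_right (0::real)"])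
        show "((\<lambda>e. exp (- (m * (c - e)))) \<longlongrightarrow> exp (- (m * c))) (at_right 0)"
          by (auto intro!: tendsto_eq_intros)
        have "young_weight \<omega> m k \<le> exp (- (m * (c - e)))" if e: "e > 0" for e
        proof -
          have "ereal (c - e) < y" using e by (simp add: 2)
          then obtain t where t: "t \<ge> 0" "ereal (c - e) < ereal (real k / m * t - \<omega> (exp t))"
            unfolding y_def young_conjugate_def less_SUP_iff by auto
          have "young_weight \<omega> m k \<le> exp (- (m * (real k / m * t - \<omega> (exp t))))"
            using young_weight_le[of "exp t" \<omega> m k] ln[of "exp t"] t by simp
          also have "\<dots> \<le> exp (- (m * (c - e)))" using t m by simp
          finally show ?thesis .
        qed
        then show "\<forall>\<^sub>F e in at_right 0. young_weight \<omega> m k \<le> exp (- (m * (c - e)))"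
          by (auto simp: eventually_at_right_field intro!: exI[of _ 1])
      qed simp
    qed
    then show ?thesis by (simp add: y_def[symmetric] 2 exp_ereal_def)
  qed
qed

section \<open>Squares, products and geometric factors of Young weights\<close>

text \<open>At the same r, the expression under the left infimum is the square of the one under the
  right infimum. The infimum need not be attained, whence the limit in e.\<close>

lemma young_weight_double:
  "young_weight \<omega> (2 * m) (2 * k) = (young_weight \<omega> m k)\<^sup>2"
proof -
  have eq: "exp (2 * m * \<omega> r) / r ^ (2 * k) = (exp (m * \<omega> r) / r ^ k)\<^sup>2" for r
    by (simp add: power_divide power_even_eq exp_double[symmetric] mult.assoc)
  show ?thesis
  proof (rule antisym)
    show "(young_weight \<omega> m k)\<^sup>2 \<le> young_weight \<omega> (2 * m) (2 * k)"
      by (rule young_weight_greatest) (auto simp: eq intro!: power_mono young_weight_le young_weight_nonneg)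
    show "young_weight \<omega> (2 * m) (2 * k) \<le> (young_weight \<omega> m k)\<^sup>2"
    proof (rule tendsto_lowerbound[of "\<lambda>e. (young_weight \<omega> m k + e)\<^sup>2" _ "at_right (0::real)"])
      show "((\<lambda>e. (young_weight \<omega> m k + e)\<^sup>2) \<longlongrightarrow> (young_weight \<omega> m k)\<^sup>2) (at_right 0)"
        by (auto intro!: tendsto_eq_intros)
      have "young_weight \<omega> (2 * m) (2 * k) \<le> (young_weight \<omega> m k + e)\<^sup>2" if e: "e > 0" for e
      proof -
        obtain r where r: "r \<ge> 1" "exp (m * \<omega> r) / r ^ k < young_weight \<omega> m k + e"
          using young_weight_le_eps[OF e] .
        have "young_weight \<omega> (2 * m) (2 * k) \<le> (exp (m * \<omega> r) / r ^ k)\<^sup>2"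
          using young_weight_le[OF r(1), of \<omega> "2 * m" "2 * k"] by (simp only: eq)
        also have "\<dots> \<le> (young_weight \<omega> m k + e)\<^sup>2" using r by (intro power_mono) auto
        finally show ?thesis .
      qed
      then show "\<forall>\<^sub>F e in at_right 0. young_weight \<omega> (2 * m) (2 * k) \<le> (young_weight \<omega> m k + e)\<^sup>2"
        by (auto simp: eventually_at_right_field intro!: exI[of _ 1])
    qed simp
  qed
qed

text \<open>Superadditivity of the Young conjugate in multiplicative form. With v the root of order
  \<open>a + b\<close> of the expression under the infimum, the smaller of \<open>v r\<close> and
  \<open>v s\<close> is a competitor for the order \<open>a + b\<close>; and \<open>v t ^ c\<close>
  is at most the expression of order c, since it uses only a fraction of the nonnegative exponent
  \<open>m * \<omega> t\<close>.\<close>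

lemma young_weight_add:
  assumes nonneg: "\<And>t. t \<ge> 0 \<Longrightarrow> \<omega> t \<ge> 0" and m: "m \<ge> 0"
  shows "young_weight \<omega> m (a + b) \<le> young_weight \<omega> m a * young_weight \<omega> m b"
proof -
  have key: "young_weight \<omega> m (a + b) \<le> (exp (m * \<omega> r) / r ^ a) * (exp (m * \<omega> s) / s ^ b)"
    if r: "r \<ge> 1" and s: "s \<ge> 1" for r s
  proof (cases "a + b = 0")
    case True
    have "young_weight \<omega> m (a + b) \<le> exp (m * \<omega> r) * 1" using young_weight_le[OF r, of \<omega> m "a+b"] True by simp
    also have "\<dots> \<le> exp (m * \<omega> r) * exp (m * \<omega> s)"
      using nonneg[of s] s m by (intro mult_left_mono) auto
    finally show ?thesis using True by simp
  next
    case False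
    define v where "v t = exp (m * \<omega> t / real (a + b)) / t" for t
    have vpow: "v t ^ (a + b) = exp (m * \<omega> t) / t ^ (a + b)" for t
    proof -
      have "exp (m * \<omega> t) = exp (real (a + b) * (m * \<omega> t / real (a + b)))"
        using False by (simp del: of_nat_add)
      then show ?thesis unfolding exp_of_nat_mult by (simp add: v_def power_divide)
    qed
    have v1: "v t ^ c \<le> exp (m * \<omega> t) / t ^ c" if "c \<le> a + b" "t \<ge> 1" for t c
    proof -
      have "v t ^ c = exp (real c * (m * \<omega> t / real (a + b))) / t ^ c"
        unfolding exp_of_nat_mult by (simp add: v_def power_divide)
      moreover have "real c * (m * \<omega> t / real (a + b)) \<le> m * \<omega> t"
      proof -
        have "real c / real (a + b) * (m * \<omega> t) \<le> 1 * (m * \<omega> t)"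
          using that False m nonneg[of t] by (intro mult_right_mono) (auto simp del: of_nat_add)
        then show ?thesis by simp
      qed
      ultimately show ?thesis using that by (auto intro!: divide_right_mono)
    qed
    have vpos: "v r > 0" "v s > 0" using r s by (auto simp: v_def)
    have "young_weight \<omega> m (a + b) \<le> v r ^ a * v s ^ b"
    proof (cases "v r \<le> v s")
      case True
      have "young_weight \<omega> m (a + b) \<le> v r ^ (a + b)" using young_weight_le[OF r] by (simp add: vpow)
      also have "\<dots> \<le> v r ^ a * v s ^ b" unfolding power_add
        using True vpos by (intro mult_left_mono power_mono) auto
      finally show ?thesis .
    next
      case False
      have "young_weight \<omega> m (a + b) \<le> v s ^ (a + b)" using young_weight_le[OF s] by (simp add: vpow)
      also have "\<dots> \<le> v r ^ a * v s ^ b" unfolding power_add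
        using False vpos by (intro mult_right_mono power_mono) auto
      finally show ?thesis .
    qed
    also have "\<dots> \<le> (exp (m * \<omega> r) / r ^ a) * (exp (m * \<omega> s) / s ^ b)"
      using r s vpos by (intro mult_mono v1) auto
    finally show ?thesis .
  qed
  have "((\<lambda>e. (young_weight \<omega> m a + e) * (young_weight \<omega> m b + e)) \<longlongrightarrow> young_weight \<omega> m a * young_weight \<omega> m b)
      (at_right 0)"
    by (auto intro!: tendsto_eq_intros)
  then show ?thesis
  proof (rule tendsto_lowerbound)
    have "young_weight \<omega> m (a + b) \<le> (young_weight \<omega> m a + e) * (young_weight \<omega> m b + e)" if e: "e > 0" for e
    proof -
      obtain r where r: "r \<ge> 1" "exp (m * \<omega> r) / r ^ a < young_weight \<omega> m a + e"
        using young_weight_le_eps[OF e] .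
      obtain s where s: "s \<ge> 1" "exp (m * \<omega> s) / s ^ b < young_weight \<omega> m b + e"
        using young_weight_le_eps[OF e] .
      have "young_weight \<omega> m (a + b) \<le> (exp (m * \<omega> r) / r ^ a) * (exp (m * \<omega> s) / s ^ b)"
        by (rule key[OF r(1) s(1)])
      also have "\<dots> \<le> (young_weight \<omega> m a + e) * (young_weight \<omega> m b + e)"
      proof (rule mult_mono)
        show "0 \<le> young_weight \<omega> m a + e" using young_weight_nonneg[of \<omega> m a] e by simp
        show "0 \<le> exp (m * \<omega> s) / s ^ b" using s(1) by simp
      qed (use r s in \<open>simp_all add: less_imp_le\<close>)
      finally show ?thesis .
    qed
    then show "\<forall>\<^sub>F e in at_right 0. young_weight \<omega> m (a + b) \<le> (young_weight \<omega> m a + e) * (young_weight \<omega> m b + e)"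
      by (auto simp: eventually_at_right_field intro!: exI[of _ 1])
  qed simp
qed

text \<open>This is how decay of a transform is converted into bounds on derivatives of all orders.
  For \<open>r < 1\<close>, outside the range of the infimum, its value at 1 shows that the Young
  weight is at most 1.\<close>

lemma power_mult_young_weight_le:
  assumes nonneg: "\<And>t. t \<ge> 0 \<Longrightarrow> \<omega> t \<ge> 0"
    and norm: "\<omega> 1 = 0" and m: "m \<ge> 0" and r: "r \<ge> 0"
  shows "r ^ k * young_weight \<omega> m k \<le> exp (m * \<omega> r)"
proof (cases "r \<ge> 1")
  case True
  then show ?thesis using young_weight_le[OF True, of \<omega> m k] by (simp add: field_simps)
next
  case False
  have "r ^ k * young_weight \<omega> m k \<le> 1 * 1"
  proof (intro mult_mono)
    show "r ^ k \<le> 1" using False r by (intro power_le_one) auto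
    show "young_weight \<omega> m k \<le> 1" using young_weight_le[of 1 \<omega> m k] norm by simp
  qed (use r young_weight_nonneg in auto)
  also have "\<dots> \<le> exp (m * \<omega> r)" using m r nonneg[of r] by simp
  finally show ?thesis .
qed

text \<open>The infimum for m is tested at \<open>2 * r\<close>: the factor \<open>2 ^ k\<close>
  cancels, and the doubling condition brings \<omega> back to r at the price of a larger
  parameter.\<close>

lemma young_weight_two_power:
  assumes K: "\<And>t. t \<ge> 0 \<Longrightarrow> \<omega> (2 * t) \<le> K * (1 + \<omega> t)" and m: "m \<ge> 0"
  shows "2 ^ k * young_weight \<omega> m k \<le> exp (m * K) * young_weight \<omega> (m * K) k"
proof -
  have "exp (- (m * K)) * (2 ^ k * young_weight \<omega> m k) \<le> young_weight \<omega> (m * K) k"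
  proof (rule young_weight_greatest)
    fix r :: real assume r: "r \<ge> 1"
    have "2 ^ k * young_weight \<omega> m k \<le> 2 ^ k * (exp (m * \<omega> (2 * r)) / (2 * r) ^ k)"
      using young_weight_le[of "2 * r" \<omega> m k] r by (intro mult_left_mono) auto
    also have "\<dots> = exp (m * \<omega> (2 * r)) / r ^ k" by (simp add: power_mult_distrib)
    also have "\<dots> \<le> exp (m * (K * (1 + \<omega> r))) / r ^ k"
      using K[of r] r m by (intro divide_right_mono) (auto intro: mult_left_mono)
    also have "\<dots> = exp (m * K) * (exp (m * K * \<omega> r) / r ^ k)"
      by (simp add: exp_add[symmetric] algebra_simps)
    finally have "exp (- (m * K)) * (2 ^ k * young_weight \<omega> m k)
        \<le> exp (- (m * K)) * (exp (m * K) * (exp (m * K * \<omega> r) / r ^ k))"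
      by (intro mult_left_mono) auto
    also have "\<dots> = exp (m * K * \<omega> r) / r ^ k" by (simp add: mult.assoc[symmetric] exp_add[symmetric])
    finally show "exp (- (m * K)) * (2 ^ k * young_weight \<omega> m k) \<le> exp (m * K * \<omega> r) / r ^ k" .
  qed
  then have "exp (m * K) * (exp (- (m * K)) * (2 ^ k * young_weight \<omega> m k)) \<le> exp (m * K) * young_weight \<omega> (m * K) k"
    by (intro mult_left_mono) auto
  then show ?thesis by (simp add: mult.assoc[symmetric] exp_add[symmetric])
qed

lemma young_weight_antimono_param:
  assumes nonneg: "\<And>t. t \<ge> 0 \<Longrightarrow> \<omega> t \<ge> 0" and "m \<le> m'"
  shows "young_weight \<omega> m k \<le> young_weight \<omega> m' k"
proof (rule young_weight_greatest)
  fix r :: real assume r: "r \<ge> 1"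
  have "young_weight \<omega> m k \<le> exp (m * \<omega> r) / r ^ k" by (rule young_weight_le[OF r])
  also have "\<dots> \<le> exp (m' * \<omega> r) / r ^ k"
    using assms r nonneg[of r] by (simp add: divide_right_mono mult_right_mono)
  finally show "young_weight \<omega> m k \<le> exp (m' * \<omega> r) / r ^ k" .
qed

text \<open>Doubling p times absorbs \<open>(2 ^ p) ^ k\<close>, and c lies below some
  \<open>2 ^ p\<close>. The case \<open>c = 2\<close> serves the Leibniz rule, the case
  \<open>c = 576\<close> the interpolation inequality.\<close>

lemma young_weight_absorb_power:
  assumes K: "\<And>t. t \<ge> 0 \<Longrightarrow> \<omega> (2 * t) \<le> K * (1 + \<omega> t)" "K \<ge> 1" and m: "m > 0" and c: "c \<ge> 0"
  obtains m' C where "m' \<ge> m" "C > 0" "\<And>k. c ^ k * young_weight \<omega> m k \<le> C * young_weight \<omega> m' k"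
proof -
  have *: "\<exists>m' C. m' \<ge> m \<and> C > 0 \<and> (\<forall>k. (2 ^ p) ^ k * young_weight \<omega> m k \<le> C * young_weight \<omega> m' k)" for p
  proof (induction p)
    case 0
    show ?case by (intro exI[of _ m] exI[of _ 1]) auto
  next
    case (Suc p)
    then obtain m' C where *: "m' \<ge> m" "C > 0"
      "\<And>k. (2 ^ p) ^ k * young_weight \<omega> m k \<le> C * young_weight \<omega> m' k" by blast
    have "m' * 1 \<le> m' * K" using * m K by (intro mult_left_mono) auto
    then have "m' * K \<ge> m" using * by simp
    moreover have "(2 ^ Suc p) ^ k * young_weight \<omega> m k \<le> (C * exp (m' * K)) * young_weight \<omega> (m' * K) k" for k
    proof -
      have "(2 ^ Suc p) ^ k * young_weight \<omega> m k = 2 ^ k * ((2 ^ p) ^ k * young_weight \<omega> m k)"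
        by (simp add: power_mult_distrib)
      also have "\<dots> \<le> 2 ^ k * (C * young_weight \<omega> m' k)" by (intro mult_left_mono *) auto
      also have "\<dots> = C * (2 ^ k * young_weight \<omega> m' k)" by simp
      also have "\<dots> \<le> C * (exp (m' * K) * young_weight \<omega> (m' * K) k)"
        using young_weight_two_power[of \<omega> K m' k] K * m by (intro mult_left_mono) auto
      finally show ?thesis by (simp add: mult.assoc)
    qed
    ultimately show ?case using * by (intro exI[of _ "m' * K"] exI[of _ "C * exp (m' * K)"]) auto
  qed
  obtain p where p: "c < 2 ^ p" using real_arch_pow[of 2 c] by auto
  from *[of p] obtain m' C where **: "m' \<ge> m" "C > 0"
      "\<And>k. (2 ^ p) ^ k * young_weight \<omega> m k \<le> C * young_weight \<omega> m' k" by blast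
  have "c ^ k * young_weight \<omega> m k \<le> C * young_weight \<omega> m' k" for k
  proof -
    have "c ^ k * young_weight \<omega> m k \<le> (2 ^ p) ^ k * young_weight \<omega> m k"
      using p c by (intro mult_right_mono power_mono young_weight_nonneg) auto
    then show ?thesis using **(3)[of k] by linarith
  qed
  with ** show ?thesis using that by blast
qed

section \<open>Fourier inversion for rapidly decreasing functions\<close>

lemma iter_partial_Nil [simp]: "iter_partial [] f = f"
  by (simp add: iter_partial_def)

lemma iter_partial_Cons [simp]: "iter_partial (i # is) f = partial_deriv i (iter_partial is f)"
  by (simp add: iter_partial_def)

text \<open>Lebesgue measure on \<open>real^'n\<close> is the image of a product measure indexed by
  basis vectors instead of \<open>'n\<close>. The function g translates between the two index sets,
  and then Fubini's theorem for finite products applies.\<close>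

lemma integral_prod_components:
  fixes f :: "'n::finite \<Rightarrow> real \<Rightarrow> 'b::{real_normed_field,banach,second_countable_topology}"
  assumes f: "\<And>i. integrable lborel (f i)"
  shows "integrable lborel (\<lambda>x::real^'n. \<Prod>i\<in>UNIV. f i (x $ i))"
    and "(LINT x|lborel. (\<Prod>i\<in>UNIV. f i ((x::real^'n) $ i))) = (\<Prod>i\<in>UNIV. LINT t|lborel. f i t)"
proof -
  interpret product_sigma_finite "\<lambda>_::real^'n. lborel :: real measure" ..
  let ?B = "Basis :: (real^'n) set"
  define g where "g b = f (axis_index b)" for b :: "real^'n"
  have B: "?B = (\<lambda>i. axis i 1) ` UNIV" by (auto simp: Basis_vec_def)
  have inj: "inj (\<lambda>i::'n. axis i (1::real))" by (auto simp: inj_on_def axis_eq_axis)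
  have meas [measurable]: "f i \<in> borel_measurable borel" for i using f[of i] by (auto dest: borel_measurable_integrable)
  have gm [measurable]: "g b \<in> borel_measurable borel" for b unfolding g_def by measurable
  have reindex: "(\<Prod>i\<in>UNIV. f i (x $ i)) = (\<Prod>b\<in>?B. g b (x \<bullet> b))" for x :: "real^'n"
    unfolding B by (subst prod.reindex[OF inj]) (simp add: g_def inner_axis)
  have reindex': "(\<Prod>i\<in>UNIV. LINT t|lborel. f i t) = (\<Prod>b\<in>?B. LINT t|lborel. g b t)"
    unfolding B by (subst prod.reindex[OF inj]) (simp add: g_def)
  have sum: "(\<Sum>b\<in>?B. y b *\<^sub>R b) \<bullet> b = y b" if "b \<in> ?B" for y b
    using that by (simp add: inner_sum_left inner_Basis if_distrib cong: if_cong)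
  have comp: "(\<Prod>b\<in>?B. g b ((\<Sum>b\<in>?B. y b *\<^sub>R b) \<bullet> b)) = (\<Prod>b\<in>?B. g b (y b))" for y
    by (intro prod.cong refl) (simp add: sum)
  have int: "integrable lborel (g b)" for b unfolding g_def by (rule f)
  have T: "(\<lambda>y. \<Sum>b\<in>?B. y b *\<^sub>R b) \<in> measurable (Pi\<^sub>M ?B (\<lambda>_. lborel)) borel" by measurable
  have m: "(\<lambda>x. \<Prod>b\<in>?B. g b (x \<bullet> b)) \<in> borel_measurable borel"
    by measurable
  show "integrable lborel (\<lambda>x::real^'n. \<Prod>i\<in>UNIV. f i (x $ i))"
    unfolding reindex by (subst lborel_eq, subst integrable_distr_eq[OF T m], unfold comp)
      (rule product_integrable_prod[OF finite_Basis int])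
  show "(LINT x|lborel. (\<Prod>i\<in>UNIV. f i ((x::real^'n) $ i))) = (\<Prod>i\<in>UNIV. LINT t|lborel. f i t)"
    unfolding reindex reindex' by (subst lborel_eq, subst integral_distr[OF T m], unfold comp)
      (rule product_integral_prod[OF finite_Basis int])
qed

lemma lborel_integral_affine:
  fixes f :: "'a::euclidean_space \<Rightarrow> 'b::{banach,second_countable_topology}"
  assumes c: "c \<noteq> 0" and f [measurable]: "f \<in> borel_measurable borel"
  shows "(LINT x|lborel. f x) = \<bar>c\<bar> ^ DIM('a) *\<^sub>R (LINT x|lborel. f (t + c *\<^sub>R x))"
  by (subst lborel_affine[OF c, of t])
    (simp add: integral_density integral_distr)

text \<open>Since \<open>1 + (x $ i)\<^sup>2 \<le> (1 + norm x)\<^sup>2\<close> for each i, a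
  product of one-dimensional functions \<open>inverse (1 + t\<^sup>2)\<close> is an integrable
  majorant; this explains the power 2 per coordinate.\<close>

lemma integrable_inverse_one_plus_norm_power:
  "integrable lborel (\<lambda>x::real^'n. inverse ((1 + norm x) ^ (2 * CARD('n))))"
proof (rule Bochner_Integration.integrable_bound)
  have "integrable lborel (\<lambda>x::real. inverse (1 + x\<^sup>2))"
    using integrable_inverse_1_plus_square by (simp add: set_integrable_def)
  then show "integrable lborel (\<lambda>x::real^'n. \<Prod>i\<in>UNIV. inverse (1 + (x $ i)\<^sup>2))"
    by (rule integral_prod_components(1))
  show "(\<lambda>x::real^'n. inverse ((1 + norm x) ^ (2 * CARD('n)))) \<in> borel_measurable lborel"
    by measurable
  have "norm (inverse ((1 + norm x) ^ (2 * CARD('n)))) \<le> norm (\<Prod>i\<in>UNIV. inverse (1 + (x $ i)\<^sup>2))" for x :: "real^'n"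
  proof -
    have le: "1 + (x $ i)\<^sup>2 \<le> (1 + norm x)\<^sup>2" for i
    proof -
      have "(x $ i)\<^sup>2 \<le> (norm x)\<^sup>2" using power_mono[OF component_le_norm_cart[of x i], of 2] by simp
      then show ?thesis by (auto simp: power2_sum intro: add_increasing2)
    qed
    have "inverse ((1 + norm x) ^ (2 * CARD('n))) = (\<Prod>i\<in>(UNIV::'n set). inverse ((1 + norm x)\<^sup>2))"
      by (simp add: power_mult power_inverse)
    also have "\<dots> \<le> (\<Prod>i\<in>UNIV. inverse (1 + (x $ i)\<^sup>2))"
      using le by (intro prod_mono conjI le_imp_inverse_le) (auto intro: add_pos_nonneg)
    finally have "inverse ((1 + norm x) ^ (2 * CARD('n))) \<le> (\<Prod>i\<in>UNIV. inverse (1 + (x $ i)\<^sup>2))" .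
    moreover have "0 \<le> inverse ((1 + norm x) ^ (2 * CARD('n)))" by simp
    ultimately show ?thesis by (simp only: real_norm_def abs_of_nonneg)
  qed
  then show "AE x::real^'n in lborel. norm (inverse ((1 + norm x) ^ (2 * CARD('n)))) \<le> norm (\<Prod>i\<in>UNIV. inverse (1 + (x $ i)\<^sup>2))"
    by simp
qed

section \<open>Rapidly decreasing functions and the derivatives of their transforms\<close>

text \<open>Derivatives are not mentioned: what counts is integrability and stability under
  multiplication by coordinates, which is all that differentiating a transform requires.\<close>

definition rapid :: "(real^'n \<Rightarrow> complex) \<Rightarrow> bool" where
  "rapid h \<longleftrightarrow> continuous_on UNIV h \<and> (\<forall>k. \<exists>C. \<forall>x. (1 + norm x) ^ k * norm (h x) \<le> C)"

lemma rapidE: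
  assumes "rapid h"
  obtains C where "C > 0" "\<And>x. norm (h x) \<le> C * inverse ((1 + norm x) ^ k)"
proof -
  obtain C where C: "\<And>x. (1 + norm x) ^ k * norm (h x) \<le> C" using assms unfolding rapid_def by blast
  have "norm (h x) \<le> (\<bar>C\<bar> + 1) * inverse ((1 + norm x) ^ k)" for x
  proof -
    have pos: "(1 + norm x) ^ k > 0" by (simp add: add_pos_nonneg)
    have "norm (h x) * (1 + norm x) ^ k \<le> \<bar>C\<bar> + 1" using C[of x] by (simp add: mult.commute)
    then show ?thesis using pos by (simp add: field_simps)
  qed
  then show ?thesis using that[of "\<bar>C\<bar> + 1"] by simp
qed

lemma rapid_continuous: "rapid h \<Longrightarrow> continuous_on UNIV h"
  by (simp add: rapid_def)

lemma rapid_borel_measurable: "rapid h \<Longrightarrow> h \<in> borel_measurable borel"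
  by (intro borel_measurable_continuous_onI rapid_continuous)

lemma rapid_integrable:
  fixes h :: "real^'n \<Rightarrow> complex"
  assumes "rapid h"
  shows "integrable lborel h"
proof -
  obtain C where C: "C > 0" "\<And>x. norm (h x) \<le> C * inverse ((1 + norm x) ^ (2 * CARD('n)))"
    using rapidE[OF assms] by blast
  show ?thesis
  proof (rule Bochner_Integration.integrable_bound)
    show "integrable lborel (\<lambda>x::real^'n. C * inverse ((1 + norm x) ^ (2 * CARD('n))))"
      by (intro integrable_mult_right integrable_inverse_one_plus_norm_power)
    show "h \<in> borel_measurable lborel" using rapid_borel_measurable[OF assms] by simp
    have "norm (h x) \<le> norm (C * inverse ((1 + norm x) ^ (2 * CARD('n))))" for x
      unfolding real_norm_def by (rule order.trans[OF C(2) abs_ge_self])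
    then show "AE x in lborel. norm (h x) \<le> norm (C * inverse ((1 + norm x) ^ (2 * CARD('n))))" by simp
  qed
qed

lemma rapid_mult_poly_bounded:
  assumes h: "rapid h" and c: "continuous_on UNIV p" and p: "\<And>x. norm (p x) \<le> B * (1 + norm x) ^ l" 
  shows "rapid (\<lambda>x. p x * h x)"
  unfolding rapid_def
proof (intro conjI allI)
  show "continuous_on UNIV (\<lambda>x. p x * h x)" by (intro continuous_intros c rapid_continuous[OF h])
  fix k
  obtain C where C: "C > 0" "\<And>x. norm (h x) \<le> C * inverse ((1 + norm x) ^ (k + l))" using rapidE[OF h] by blast
  have "(1 + norm x) ^ k * norm (p x * h x) \<le> B * C" for x
  proof -
    have pos: "(1 + norm x) > 0" by (simp add: add_pos_nonneg)
    have B: "0 \<le> B * (1 + norm x) ^ l" using p[of x] norm_ge_zero[of "p x"] by linarith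
    have "(1 + norm x) ^ k * norm (p x * h x)
        \<le> (1 + norm x) ^ k * ((B * (1 + norm x) ^ l) * (C * inverse ((1 + norm x) ^ (k + l))))"
      unfolding norm_mult using pos C p B by (intro mult_left_mono mult_mono) auto
    also have "\<dots> = B * C" using pos by (simp add: field_simps power_add)
    finally show ?thesis .
  qed
  then show "\<exists>C. \<forall>x. (1 + norm x) ^ k * norm (p x * h x) \<le> C" by blast
qed

lemma rapid_component:
  fixes h :: "real^'n \<Rightarrow> complex"
  assumes "rapid h"
  shows "rapid (\<lambda>x. - \<i> * complex_of_real (x $ i) * h x)"
proof (rule rapid_mult_poly_bounded[OF assms, of _ 1 1])
  show "norm (- \<i> * complex_of_real (x $ i)) \<le> 1 * (1 + norm x) ^ 1" for x :: "real^'n"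
    using component_le_norm_cart[of x i] by (simp add: norm_mult)
qed (intro continuous_intros)

lemma rapid_norm_integrable:
  assumes "rapid h"
  shows "integrable lborel (\<lambda>x. norm x ^ k * norm (h x))"
proof -
  have "rapid (\<lambda>x. complex_of_real (norm x ^ k) * h x)"
    by (rule rapid_mult_poly_bounded[OF assms, of _ 1 k])
      (auto intro!: continuous_intros power_mono simp: norm_power)
  from integrable_norm[OF rapid_integrable[OF this]] show ?thesis by (simp add: norm_mult norm_power)
qed

lemma integrable_cis_mult:
  fixes h :: "'a::euclidean_space \<Rightarrow> complex"
  assumes "integrable lborel h" and u: "continuous_on UNIV u"
  shows "integrable lborel (\<lambda>x. cis (u x) * h x)"
proof (rule Bochner_Integration.integrable_bound[OF assms(1)])
  have [measurable]: "(\<lambda>x. cis (u x)) \<in> borel_measurable borel"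
    by (intro borel_measurable_continuous_onI continuous_intros u)
  have [measurable]: "h \<in> borel_measurable borel" using assms(1) by (auto dest: borel_measurable_integrable)
  show "(\<lambda>x. cis (u x) * h x) \<in> borel_measurable lborel" by measurable
qed (simp add: norm_mult)

lemma integrable_fourier_integrand:
  assumes "integrable lborel h"
  shows "integrable lborel (\<lambda>x::real^'n. cis (- (x \<bullet> \<xi>)) * h x)"
  by (rule integrable_cis_mult[OF assms]) (intro continuous_intros)

lemma norm_fourier_le: "norm (fourier h \<xi>) \<le> (LINT x|lborel. norm (h x))"
proof -
  have "norm (fourier h \<xi>) \<le> (LINT x|lborel. norm (cis (- (x \<bullet> \<xi>)) * h x))"
    unfolding fourier_def by (rule integral_norm_bound)
  then show ?thesis by (simp add: norm_mult)
qed

lemma norm_cis_diff_one: "norm (cis t - 1) \<le> \<bar>t\<bar>"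
  using iexp_approx1[of t 0] by (simp add: cis_conv_exp)

lemma norm_cis_diff_linear: "norm (cis t - 1 - \<i> * t) \<le> t\<^sup>2 / 2"
  using iexp_approx1[of t 1] by (simp add: cis_conv_exp numeral_2_eq_2 algebra_simps)

text \<open>The transform is even Lipschitz, with the first absolute moment of h as constant,
  because \<open>norm (cis t - 1) \<le> \<bar>t\<bar>\<close>.\<close>

lemma continuous_fourier:
  fixes h :: "real^'n \<Rightarrow> complex"
  assumes h: "rapid h"
  shows "continuous_on UNIV (fourier h)"
proof -
  define M where "M = (LINT x|lborel. norm x ^ 1 * norm (h x))"
  have int: "integrable lborel (\<lambda>x. norm x ^ 1 * norm (h x))" by (rule rapid_norm_integrable[OF h])
  have lip: "dist (fourier h \<xi>) (fourier h \<eta>) \<le> M * dist \<xi> \<eta>" for \<xi> \<eta>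
  proof -
    have "fourier h \<xi> - fourier h \<eta> = (LINT x|lborel. (cis (- (x \<bullet> \<xi>)) - cis (- (x \<bullet> \<eta>))) * h x)"
      unfolding fourier_def left_diff_distrib
      by (intro Bochner_Integration.integral_diff[symmetric] integrable_fourier_integrand rapid_integrable[OF h])
    also have "norm \<dots> \<le> (LINT x|lborel. norm (\<xi> - \<eta>) * (norm x ^ 1 * norm (h x)))"
    proof (rule Bochner_Integration.integral_norm_bound_integral)
      show "integrable lborel (\<lambda>x. (cis (- (x \<bullet> \<xi>)) - cis (- (x \<bullet> \<eta>))) * h x)"
        unfolding left_diff_distrib
        by (intro Bochner_Integration.integrable_diff integrable_fourier_integrand rapid_integrable[OF h])
      show "integrable lborel (\<lambda>x. norm (\<xi> - \<eta>) * (norm x ^ 1 * norm (h x)))" using int by simp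
      fix x :: "real^'n"
      have "cis (- (x \<bullet> \<xi>)) - cis (- (x \<bullet> \<eta>)) = cis (- (x \<bullet> \<eta>)) * (cis (- (x \<bullet> (\<xi> - \<eta>))) - 1)"
        by (simp add: algebra_simps cis_mult inner_diff_right)
      then have "norm (cis (- (x \<bullet> \<xi>)) - cis (- (x \<bullet> \<eta>))) \<le> \<bar>x \<bullet> (\<xi> - \<eta>)\<bar>"
        using norm_cis_diff_one[of "- (x \<bullet> (\<xi> - \<eta>))"] by (simp add: norm_mult)
      also have "\<dots> \<le> norm x * norm (\<xi> - \<eta>)" by (rule Cauchy_Schwarz_ineq2)
      finally have "norm (cis (- (x \<bullet> \<xi>)) - cis (- (x \<bullet> \<eta>))) * norm (h x) \<le> norm x * norm (\<xi> - \<eta>) * norm (h x)"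
        by (intro mult_right_mono) auto
      then show "norm ((cis (- (x \<bullet> \<xi>)) - cis (- (x \<bullet> \<eta>))) * h x) \<le> norm (\<xi> - \<eta>) * (norm x ^ 1 * norm (h x))"
        by (simp add: norm_mult mult_ac)
    qed
    finally show ?thesis by (simp add: dist_norm M_def mult.commute)
  qed
  have M: "M \<ge> 0" unfolding M_def by (intro Bochner_Integration.integral_nonneg) auto
  have "M-lipschitz_on UNIV (fourier h)" by (rule lipschitz_onI) (use lip M in auto)
  then show ?thesis by (rule lipschitz_on_continuous_on)
qed

lemma has_vector_derivative_quadratic_remainder:
  fixes f :: "real \<Rightarrow> 'a::real_normed_vector"
  assumes "\<And>t. norm (f t - f 0 - t *\<^sub>R v) \<le> M * t\<^sup>2"
  shows "(f has_vector_derivative v) (at 0)"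
  unfolding has_vector_derivative_def has_derivative_at
proof
  show "bounded_linear (\<lambda>t. t *\<^sub>R v)" by (rule bounded_linear_scaleR_left)
  show "(\<lambda>h. norm (f (0 + h) - f 0 - h *\<^sub>R v) / norm h) \<midarrow>0\<rightarrow> 0"
  proof (rule Lim_null_comparison)
    show "\<forall>\<^sub>F h in at 0. norm (norm (f (0 + h) - f 0 - h *\<^sub>R v) / norm h) \<le> M * \<bar>h\<bar>"
    proof (rule eventuallyI)
      fix h :: real
      show "norm (norm (f (0 + h) - f 0 - h *\<^sub>R v) / norm h) \<le> M * \<bar>h\<bar>"
      proof (cases "h = 0")
        case False
        have "norm (f h - f 0 - h *\<^sub>R v) \<le> (M * \<bar>h\<bar>) * \<bar>h\<bar>"
          using assms[of h] by (simp add: power2_eq_square mult.assoc)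
        then show ?thesis using False by (simp add: pos_divide_le_eq)
      qed simp
    qed
    show "((\<lambda>h. M * \<bar>h\<bar>) \<longlongrightarrow> 0) (at 0)" by (auto intro!: tendsto_eq_intros)
  qed
qed

text \<open>The integral of the first order Taylor remainder of \<open>cis\<close> is quadratic in
  t, with half the second absolute moment of h as constant. This explicit remainder takes the place
  of a convergence theorem.\<close>

lemma fourier_has_partial_derivative:
  fixes h :: "real^'n \<Rightarrow> complex"
  assumes h: "rapid h"
  shows "((\<lambda>t. fourier h (\<xi> + t *\<^sub>R axis i 1)) has_vector_derivative
      fourier (\<lambda>x. - \<i> * complex_of_real (x $ i) * h x) \<xi>) (at 0)"
proof (rule has_vector_derivative_quadratic_remainder)
  define M where "M = (LINT x|lborel. norm x ^ 2 * norm (h x))"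
  have int: "integrable lborel (\<lambda>x. norm x ^ 2 * norm (h x))" by (rule rapid_norm_integrable[OF h])
  let ?h = "\<lambda>x. - \<i> * complex_of_real (x $ i) * h x"
  fix t :: real
  let ?R = "\<lambda>x. cis (- (x \<bullet> (\<xi> + t *\<^sub>R axis i 1))) * h x - cis (- (x \<bullet> \<xi>)) * h x - t *\<^sub>R (cis (- (x \<bullet> \<xi>)) * ?h x)"
  note I = integrable_fourier_integrand[OF rapid_integrable[OF h]]
    integrable_fourier_integrand[OF rapid_integrable[OF rapid_component[OF h]]]
  have "fourier h (\<xi> + t *\<^sub>R axis i 1) - fourier h (\<xi> + 0 *\<^sub>R axis i 1) - t *\<^sub>R fourier ?h \<xi> = (LINT x|lborel. ?R x)"
    unfolding fourier_def using I by simp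
  also have "norm \<dots> \<le> (LINT x|lborel. t\<^sup>2 / 2 * (norm x ^ 2 * norm (h x)))"
  proof (rule Bochner_Integration.integral_norm_bound_integral)
    show "integrable lborel ?R"
      using I by (intro Bochner_Integration.integrable_diff integrable_scaleR_right) auto
    show "integrable lborel (\<lambda>x. t\<^sup>2 / 2 * (norm x ^ 2 * norm (h x)))" using int by simp
    fix x :: "real^'n"
    let ?E = "cis (- (t * x $ i)) - 1 - \<i> * complex_of_real (- (t * x $ i))"
    have "?R x = cis (- (x \<bullet> \<xi>)) * ?E * h x"
    proof -
      have "cis (- (x \<bullet> (\<xi> + t *\<^sub>R axis i 1))) = cis (- (x \<bullet> \<xi>)) * cis (- (t * x $ i))"
        by (simp add: cis_mult inner_add_right inner_axis)
      then show ?thesis by (simp only:) (simp add: algebra_simps scaleR_conv_of_real)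
    qed
    then have "norm (?R x) = norm ?E * norm (h x)" by (simp only: norm_mult norm_cis mult_1_left)
    also have "norm ?E \<le> (t * x $ i)\<^sup>2 / 2"
      using norm_cis_diff_linear[of "- (t * x $ i)"] by (simp only: power2_minus)
    then have "norm ?E * norm (h x) \<le> (t * x $ i)\<^sup>2 / 2 * norm (h x)" by (intro mult_right_mono) auto
    also have "\<dots> = t\<^sup>2 / 2 * (\<bar>x $ i\<bar>\<^sup>2 * norm (h x))" by (simp add: power_mult_distrib)
    also have "\<dots> \<le> t\<^sup>2 / 2 * (norm x ^ 2 * norm (h x))"
      using component_le_norm_cart[of x i] by (intro mult_left_mono mult_right_mono power_mono) auto
    finally show "norm (?R x) \<le> t\<^sup>2 / 2 * (norm x ^ 2 * norm (h x))" .
  qed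
  finally show "norm (fourier h (\<xi> + t *\<^sub>R axis i 1) - fourier h (\<xi> + 0 *\<^sub>R axis i 1) - t *\<^sub>R fourier ?h \<xi>) \<le> (M / 2) * t\<^sup>2"
    by (simp add: M_def mult.commute)
qed

lemma partial_deriv_fourier:
  "rapid h \<Longrightarrow> partial_deriv i (fourier h) = fourier (\<lambda>x. - \<i> * complex_of_real (x $ i) * h x)"
  unfolding partial_deriv_def by (intro ext vector_derivative_at fourier_has_partial_derivative)

lemma rapid_monomial:
  "rapid h \<Longrightarrow> rapid (\<lambda>x. (\<Prod>i\<leftarrow>is. - \<i> * complex_of_real (x $ i)) * h x)"
proof (induction "is")
  case (Cons i "is")
  from rapid_component[OF Cons.IH[OF Cons.prems], of i] show ?case by (simp add: mult.assoc)
qed simp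

lemma iter_partial_fourier:
  "rapid h \<Longrightarrow> iter_partial is (fourier h) = fourier (\<lambda>x. (\<Prod>i\<leftarrow>is. - \<i> * complex_of_real (x $ i)) * h x)"
proof (induction "is")
  case (Cons i "is")
  then have "iter_partial (i # is) (fourier h)
      = partial_deriv i (fourier (\<lambda>x. (\<Prod>i\<leftarrow>is. - \<i> * complex_of_real (x $ i)) * h x))"
    by simp
  also have "\<dots> = fourier (\<lambda>x. - \<i> * complex_of_real (x $ i) * ((\<Prod>i\<leftarrow>is. - \<i> * complex_of_real (x $ i)) * h x))"
    by (rule partial_deriv_fourier[OF rapid_monomial[OF Cons.prems]])
  finally show ?case by (simp add: mult.assoc)
qed simp

lemma smooth_fourier:
  assumes "rapid h"
  shows "smooth (fourier h)"
  unfolding smooth_def iter_partial_fourier[OF assms]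
  by (intro allI conjI continuous_fourier rapid_monomial assms
      differentiableI_vector[OF fourier_has_partial_derivative[OF rapid_monomial[OF assms]]])

text \<open>Differentiating a transform multiplies h by coordinate functions, and these commute.
  Inversion will extend this symmetry to all members of the space.\<close>

lemma iter_partial_fourier_perm:
  assumes "rapid h" "mset is = mset js"
  shows "iter_partial is (fourier h) = iter_partial js (fourier h)"
proof -
  have "(\<Prod>i\<leftarrow>is. f i) = (\<Prod>i\<leftarrow>js. f i)" for f :: "'a \<Rightarrow> complex"
    using assms(2) by (metis mset_map prod_mset_prod_list)
  then show ?thesis by (simp add: iter_partial_fourier[OF assms(1)])
qed

section \<open>The multiplication formula, Gaussians and inversion\<close>

text \<open>Both sides are the same double integral in the two orders of integration. With a
  Gaussian F the formula leads to inversion; with \<open>fourier H\<close> as one factor of a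
  product it is the convolution formula.\<close>

lemma fourier_mult_fourier:
  fixes F H :: "real^'n \<Rightarrow> complex"
  assumes F: "integrable lborel F" and H: "integrable lborel H"
  shows "fourier (\<lambda>x. F x * fourier H x) \<xi> = (LINT \<eta>|lborel. H \<eta> * fourier F (\<xi> + \<eta>))"
proof -
  have [measurable]: "F \<in> borel_measurable borel" "H \<in> borel_measurable borel"
    using F H by (auto dest: borel_measurable_integrable)
  define \<Phi> where "\<Phi> x \<eta> = cis (- (x \<bullet> (\<xi> + \<eta>))) * (F x * H \<eta>)" for x \<eta>
  have "continuous_on UNIV (\<lambda>p::(real^'n)\<times>(real^'n). cis (- (fst p \<bullet> (\<xi> + snd p))))"
    by (intro continuous_intros)
  then have [measurable]: "(\<lambda>p::(real^'n)\<times>(real^'n). cis (- (fst p \<bullet> (\<xi> + snd p)))) \<in> borel_measurable (borel \<Otimes>\<^sub>M borel)"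
    unfolding borel_prod by (rule borel_measurable_continuous_onI)
  have int_y: "integrable lborel (\<lambda>\<eta>. \<Phi> x \<eta>)" for x
    unfolding \<Phi>_def by (rule integrable_cis_mult) (use H in \<open>auto intro!: continuous_intros\<close>)
  have "integrable (lborel \<Otimes>\<^sub>M lborel) (case_prod \<Phi>)"
  proof (rule lborel_pair.Fubini_integrable)
    have "(\<lambda>p. cis (- (fst p \<bullet> (\<xi> + snd p))) * (F (fst p) * H (snd p))) \<in> borel_measurable (lborel \<Otimes>\<^sub>M lborel)"
      by measurable
    then show "case_prod \<Phi> \<in> borel_measurable (lborel \<Otimes>\<^sub>M lborel)"
      by (simp add: \<Phi>_def split_beta')
    have "(\<lambda>x. LINT \<eta>|lborel. norm (case_prod \<Phi> (x, \<eta>))) = (\<lambda>x. norm (F x) * (LINT \<eta>|lborel. norm (H \<eta>)))"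
      by (simp add: \<Phi>_def norm_mult)
    then show "integrable lborel (\<lambda>x. LINT \<eta>|lborel. norm (case_prod \<Phi> (x, \<eta>)))"
      using F by simp
  qed (simp add: int_y)
  from lborel_pair.Fubini_integral[OF this]
  have "(LINT \<eta>|lborel. LINT x|lborel. \<Phi> x \<eta>) = (LINT x|lborel. LINT \<eta>|lborel. \<Phi> x \<eta>)" .
  moreover have "(LINT \<eta>|lborel. \<Phi> x \<eta>) = cis (- (x \<bullet> \<xi>)) * (F x * fourier H x)" for x
  proof -
    have "\<Phi> x \<eta> = cis (- (x \<bullet> \<xi>)) * F x * (cis (- (\<eta> \<bullet> x)) * H \<eta>)" for \<eta>
    proof -
      have "cis (- (x \<bullet> (\<xi> + \<eta>))) = cis (- (x \<bullet> \<xi>)) * cis (- (\<eta> \<bullet> x))"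
        by (simp add: cis_mult inner_add_right inner_commute[of x \<eta>])
      then show ?thesis by (simp add: \<Phi>_def)
    qed
    then show ?thesis by (simp add: fourier_def)
  qed
  moreover have "(LINT x|lborel. \<Phi> x \<eta>) = H \<eta> * fourier F (\<xi> + \<eta>)" for \<eta>
  proof -
    have "\<Phi> x \<eta> = H \<eta> * (cis (- (x \<bullet> (\<xi> + \<eta>))) * F x)" for x
      by (simp add: \<Phi>_def algebra_simps)
    then show ?thesis by (simp add: fourier_def)
  qed
  ultimately show ?thesis by (simp add: fourier_def)
qed

definition gaussian :: "real^'n \<Rightarrow> complex" where
  "gaussian x = complex_of_real (exp (- (norm x)\<^sup>2 / 2))"

text \<open>This is the characteristic function of the standard normal distribution, freed of the
  normalizing factor.\<close>

lemma gaussian_1d: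
  shows "integrable lborel (\<lambda>x::real. iexp (t * x) * complex_of_real (exp (- x\<^sup>2 / 2)))"
    and "(LINT x|lborel. iexp (t * x) * complex_of_real (exp (- x\<^sup>2 / 2))) = complex_of_real (sqrt (2 * pi) * exp (- t\<^sup>2 / 2))"
proof -
  have d: "std_normal_density x *\<^sub>R iexp (t * x) = (1 / sqrt (2 * pi)) *\<^sub>R (iexp (t * x) * complex_of_real (exp (- x\<^sup>2 / 2)))" for x
    by (simp add: std_normal_density_def scaleR_conv_of_real)
  have "integrable lborel std_normal_density" by simp
  then have "integrable lborel (\<lambda>x. complex_of_real (sqrt (2 * pi) * std_normal_density x))" by simp
  then have "integrable lborel (\<lambda>x. cis (t * x) * complex_of_real (sqrt (2 * pi) * std_normal_density x))"
    by (rule integrable_cis_mult) (intro continuous_intros)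
  then show "integrable lborel (\<lambda>x::real. iexp (t * x) * complex_of_real (exp (- x\<^sup>2 / 2)))"
    by (simp add: std_normal_density_def cis_conv_exp)
  have "exp (- t\<^sup>2 / 2) = char std_normal_distribution t" by (simp add: char_std_normal_distribution)
  also have "\<dots> = (LINT x|lborel. std_normal_density x *\<^sub>R iexp (t * x))"
    unfolding char_def by (subst integral_density) auto
  also have "\<dots> = (1 / sqrt (2 * pi)) *\<^sub>R (LINT x|lborel. iexp (t * x) * complex_of_real (exp (- x\<^sup>2 / 2)))"
    unfolding d by simp
  finally show "(LINT x|lborel. iexp (t * x) * complex_of_real (exp (- x\<^sup>2 / 2))) = complex_of_real (sqrt (2 * pi) * exp (- t\<^sup>2 / 2))"
    by (simp add: scaleR_conv_of_real field_simps)
qed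

lemma norm_square_components: "(norm (x :: real^'n))\<^sup>2 = (\<Sum>i\<in>UNIV. (x $ i)\<^sup>2)"
  unfolding power2_norm_eq_inner inner_vec_def by (simp add: power2_eq_square)

lemma cis_sum: "finite A \<Longrightarrow> cis (\<Sum>i\<in>A. f i) = (\<Prod>i\<in>A. cis (f i))"
  by (induction A rule: finite_induct) (auto simp: cis_mult[symmetric])

lemma fourier_gaussian:
  shows "integrable lborel (gaussian :: real^'n \<Rightarrow> complex)"
    and "fourier gaussian (\<xi> :: real^'n) = complex_of_real (sqrt (2 * pi) ^ CARD('n)) * gaussian \<xi>"
proof -
  have gauss_prod: "gaussian y = (\<Prod>i\<in>UNIV. complex_of_real (exp (- (y $ i)\<^sup>2 / 2)))" for y :: "real^'n"
    unfolding gaussian_def norm_square_components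
    by (simp add: sum_negf[symmetric] sum_divide_distrib exp_sum)
  have integrand: "cis (- (x \<bullet> \<xi>)) * gaussian x = (\<Prod>i\<in>UNIV. iexp (- \<xi> $ i * x $ i) * complex_of_real (exp (- (x $ i)\<^sup>2 / 2)))"
    for x \<xi> :: "real^'n"
  proof -
    have "cis (- (x \<bullet> \<xi>)) = (\<Prod>i\<in>UNIV. cis (- (\<xi> $ i * x $ i)))"
      by (subst cis_sum[symmetric]) (simp_all add: inner_vec_def sum_negf mult.commute)
    then show ?thesis unfolding gauss_prod prod.distrib by (simp add: cis_conv_exp)
  qed
  have "integrable lborel (\<lambda>x::real^'n. cis (- (x \<bullet> 0)) * gaussian x)"
    unfolding integrand by (intro integral_prod_components(1) gaussian_1d(1))
  then show "integrable lborel (gaussian :: real^'n \<Rightarrow> complex)" by simp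
  have "fourier gaussian \<xi> = (\<Prod>i\<in>UNIV. complex_of_real (sqrt (2 * pi) * exp (- (- \<xi> $ i)\<^sup>2 / 2)))"
    unfolding fourier_def integrand
    by (subst integral_prod_components(2)[OF gaussian_1d(1)]) (simp only: gaussian_1d(2))
  then show "fourier gaussian (\<xi> :: real^'n) = complex_of_real (sqrt (2 * pi) ^ CARD('n)) * gaussian \<xi>"
    unfolding gauss_prod by (simp add: prod.distrib)
qed

lemma gaussian_measurable [measurable]: "gaussian \<in> borel_measurable borel"
  unfolding gaussian_def by measurable

lemma norm_gaussian_le_1: "norm (gaussian x) \<le> 1"
  by (simp add: gaussian_def)

lemma fourier_gaussian_scaled:
  fixes \<xi> :: "real^'n"
  assumes e: "e > 0"
  shows "integrable lborel (\<lambda>x::real^'n. gaussian (e *\<^sub>R x))"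
    and "e ^ CARD('n) *\<^sub>R fourier (\<lambda>x. gaussian (e *\<^sub>R x)) \<xi> = complex_of_real (sqrt (2 * pi) ^ CARD('n)) * gaussian (\<xi> /\<^sub>R e)"
proof -
  have "integrable (density (distr lborel borel (\<lambda>x. 0 + e *\<^sub>R x)) (\<lambda>_. \<bar>e\<bar> ^ DIM(real^'n))) (gaussian :: real^'n \<Rightarrow> complex)"
    using lborel_affine[of e "0::real^'n"] e fourier_gaussian(1)[where 'n='n] by simp
  then have "integrable lborel (\<lambda>x::real^'n. \<bar>e\<bar> ^ DIM(real^'n) *\<^sub>R gaussian (0 + e *\<^sub>R x))"
    using e by (subst (asm) integrable_density) (auto simp: integrable_distr_eq)
  then have "integrable lborel (\<lambda>x::real^'n. inverse (\<bar>e\<bar> ^ DIM(real^'n)) *\<^sub>R (\<bar>e\<bar> ^ DIM(real^'n) *\<^sub>R gaussian (0 + e *\<^sub>R x)))"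
    by (rule integrable_scaleR_right)
  then show "integrable lborel (\<lambda>x::real^'n. gaussian (e *\<^sub>R x))" using e by simp
  have m: "(\<lambda>x::real^'n. cis (- (x \<bullet> (\<xi> /\<^sub>R e))) * gaussian x) \<in> borel_measurable borel"
    by (intro borel_measurable_times gaussian_measurable borel_measurable_continuous_onI continuous_intros)
  have *: "fourier gaussian (\<xi> /\<^sub>R e) = \<bar>e\<bar> ^ DIM(real^'n) *\<^sub>R
     (LINT x|lborel. cis (- ((0 + e *\<^sub>R x) \<bullet> (\<xi> /\<^sub>R e))) * gaussian (0 + e *\<^sub>R x))"
    unfolding fourier_def by (rule lborel_integral_affine[OF _ m]) (use e in auto)
  show "e ^ CARD('n) *\<^sub>R fourier (\<lambda>x. gaussian (e *\<^sub>R x)) \<xi> = complex_of_real (sqrt (2 * pi) ^ CARD('n)) * gaussian (\<xi> /\<^sub>R e)"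
  proof -
    have "(0 + e *\<^sub>R x) \<bullet> (\<xi> /\<^sub>R e) = x \<bullet> \<xi>" for x :: "real^'n" using e by simp
    then have "(LINT x|lborel. cis (- ((0 + e *\<^sub>R x) \<bullet> (\<xi> /\<^sub>R e))) * gaussian (0 + e *\<^sub>R x)) = fourier (\<lambda>x. gaussian (e *\<^sub>R x)) \<xi>"
      unfolding fourier_def by (simp only: add_0_left)
    with * show ?thesis using e by (simp add: fourier_gaussian(2))
  qed
qed

text \<open>Gaussian regularization: the damping factor \<open>gaussian (e n *\<^sub>R y)\<close>
  tends to 1 as \<open>e n\<close> tends to 0, and it makes the multiplication formula applicable,
  whose other side averages h near x against a Gaussian.\<close>

lemma fourier_inversion:
  fixes h :: "real^'n \<Rightarrow> complex"
  assumes h: "rapid h" and fh: "rapid (fourier h)"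
  shows "fourier (fourier h) (- x) = complex_of_real ((2 * pi) ^ CARD('n)) * h x"
proof -
  define e where "e n = 1 / real (Suc n)" for n
  have e: "e n > 0" for n by (simp add: e_def)
  have e0: "e \<longlonglongrightarrow> 0" unfolding e_def by (rule LIMSEQ_Suc[OF lim_1_over_n])
  \<comment> \<open>The total mass of the Gaussian. It enters twice, from the transform of the
    damping factor and from the final integral, so \<open>s * s\<close> is the constant of the
    inversion formula.\<close>
  define s where "s = complex_of_real (sqrt (2 * pi) ^ CARD('n))"
  obtain C where C: "C > 0" "\<And>x. norm (h x) \<le> C * inverse ((1 + norm x) ^ 0)" using rapidE[OF h] by blast
  have [measurable]: "h \<in> borel_measurable borel" "fourier h \<in> borel_measurable borel"
    using h fh by (auto intro: rapid_borel_measurable)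
  have gauss_lim: "(\<lambda>n. gaussian (e n *\<^sub>R y)) \<longlonglongrightarrow> 1" for y :: "real^'n"
  proof -
    have "(\<lambda>n. gaussian (e n *\<^sub>R y)) \<longlonglongrightarrow> complex_of_real (exp (- (norm (0 *\<^sub>R y))\<^sup>2 / 2))"
      unfolding gaussian_def by (intro tendsto_intros e0) auto
    then show ?thesis by simp
  qed
  have cis_m [measurable]: "(\<lambda>y::real^'n. cis (- (y \<bullet> - x))) \<in> borel_measurable borel"
    by (intro borel_measurable_continuous_onI continuous_intros)
  have lhs: "(\<lambda>n. fourier (\<lambda>y. gaussian (e n *\<^sub>R y) * fourier h y) (- x)) \<longlonglongrightarrow> fourier (fourier h) (- x)"
    unfolding fourier_def[of _ "- x"]
  proof (rule integral_dominated_convergence)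
    show "integrable lborel (\<lambda>y. norm (fourier h y))" by (intro integrable_norm rapid_integrable fh)
    show "AE y in lborel. (\<lambda>n. cis (- (y \<bullet> - x)) * (gaussian (e n *\<^sub>R y) * fourier h y)) \<longlonglongrightarrow> cis (- (y \<bullet> - x)) * fourier h y"
      using tendsto_mult[OF tendsto_const tendsto_mult[OF gauss_lim tendsto_const]] by auto
    show "AE y in lborel. norm (cis (- (y \<bullet> - x)) * (gaussian (e n *\<^sub>R y) * fourier h y)) \<le> norm (fourier h y)" for n
      by (simp add: norm_mult mult_left_le_one_le norm_gaussian_le_1)
  qed (use cis_m in measurable)
  have "fourier (\<lambda>y. gaussian (e n *\<^sub>R y) * fourier h y) (- x) = (LINT z|lborel. s * (h (x + e n *\<^sub>R z) * gaussian z))" for n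
  proof -
    have "fourier (\<lambda>y. gaussian (e n *\<^sub>R y) * fourier h y) (- x)
        = (LINT \<eta>|lborel. h \<eta> * fourier (\<lambda>y. gaussian (e n *\<^sub>R y)) (- x + \<eta>))"
      by (rule fourier_mult_fourier[OF fourier_gaussian_scaled(1)[OF e] rapid_integrable[OF h]])
    also have "\<dots> = (LINT \<eta>|lborel. h \<eta> * ((s * gaussian ((\<eta> - x) /\<^sub>R e n)) /\<^sub>R e n ^ CARD('n)))"
    proof -
      have "fourier (\<lambda>y. gaussian (e n *\<^sub>R y)) \<xi> = (s * gaussian (\<xi> /\<^sub>R e n)) /\<^sub>R e n ^ CARD('n)" for \<xi> :: "real^'n"
        using fourier_gaussian_scaled(2)[OF e, of n \<xi>] e[of n] unfolding s_def[symmetric]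
        by (metis (no_types, lifting) less_irrefl power_not_zero scaleR_left_imp_eq scaleR_scaleR right_inverse scaleR_one)
      then show ?thesis by simp
    qed
    \<comment> \<open>The substitution \<open>\<eta> = x + e n *\<^sub>R z\<close> makes the
      Gaussian independent of n and moves the scaling into the argument of h; the Jacobian cancels
      the power of \<open>e n\<close>.\<close>
    also have "\<dots> = \<bar>e n\<bar> ^ DIM(real^'n) *\<^sub>R (LINT z|lborel. h (x + e n *\<^sub>R z) * ((s * gaussian ((x + e n *\<^sub>R z - x) /\<^sub>R e n)) /\<^sub>R e n ^ CARD('n)))"
    proof (rule lborel_integral_affine)
      show "e n \<noteq> 0" using e[of n] by simp
    qed measurable
    also have "\<dots> = (LINT z|lborel. s * (h (x + e n *\<^sub>R z) * gaussian z))"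
      using e[of n] by (simp flip: integral_scaleR_right) (simp add: mult.left_commute)
    finally show ?thesis .
  qed
  moreover have "(\<lambda>n. LINT z|lborel. s * (h (x + e n *\<^sub>R z) * gaussian z)) \<longlonglongrightarrow> (LINT z|lborel. s * (h x * gaussian (z::real^'n)))"
  proof (rule integral_dominated_convergence)
    show "integrable lborel (\<lambda>z::real^'n. norm s * (C * norm (gaussian z)))"
      using integrable_norm[OF fourier_gaussian(1)[where 'n='n]] by simp
    show "AE z in lborel. norm (s * (h (x + e n *\<^sub>R z) * gaussian z)) \<le> norm s * (C * norm (gaussian z))" for n
      using C by (auto simp: norm_mult intro!: mult_left_mono mult_right_mono)
    have "(\<lambda>n. h (x + e n *\<^sub>R z)) \<longlonglongrightarrow> h x" for z
    proof -
      have "(\<lambda>n. x + e n *\<^sub>R z) \<longlonglongrightarrow> x + 0 *\<^sub>R z" by (intro tendsto_intros e0)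
      then show ?thesis
        using rapid_continuous[OF h] by (auto simp: continuous_on_eq_continuous_at isCont_def intro: isCont_tendsto_compose)
    qed
    then show "AE z in lborel. (\<lambda>n. s * (h (x + e n *\<^sub>R z) * gaussian z)) \<longlonglongrightarrow> s * (h x * gaussian z)"
      by (auto intro!: tendsto_intros)
  qed measurable
  ultimately have "fourier (fourier h) (- x) = (LINT z|lborel. s * (h x * gaussian (z::real^'n)))"
    using LIMSEQ_unique[OF lhs] by simp
  also have "\<dots> = s * (h x * (LINT z|lborel. gaussian (z::real^'n)))" by simp
  also have "\<dots> = s * (h x * s)"
    using fourier_gaussian(2)[of "0::real^'n"] by (simp add: fourier_def s_def gaussian_def)
  also have "\<dots> = complex_of_real ((2 * pi) ^ CARD('n)) * h x"
  proof -
    have "sqrt (2 * pi) ^ CARD('n) * sqrt (2 * pi) ^ CARD('n) = (2 * pi) ^ CARD('n)"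
      by (subst power_mult_distrib[symmetric]) simp
    then have "s * s = complex_of_real ((2 * pi) ^ CARD('n))"
      unfolding s_def of_real_mult[symmetric] by (simp only:)
    then show ?thesis by (simp only: mult.left_commute[of s] mult.commute[of _ "h x"])
  qed
  finally show ?thesis .
qed

lemma rapid_reflect:
  fixes h :: "real^'n \<Rightarrow> complex"
  assumes "rapid h"
  shows "rapid (\<lambda>x. c * h (- x))"
  unfolding rapid_def
proof (intro conjI allI)
  show "continuous_on UNIV (\<lambda>x. c * h (- x))"
  proof (rule continuous_on_mult_left, rule continuous_on_compose2[of UNIV h])
    show "continuous_on UNIV h" by (rule rapid_continuous[OF assms])
    show "continuous_on UNIV (\<lambda>x::real^'n. - x)" by (intro continuous_intros)
  qed simp
  fix k
  obtain C where C: "\<And>x. (1 + norm x) ^ k * norm (h x) \<le> C" using assms unfolding rapid_def by blast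
  have "(1 + norm x) ^ k * norm (c * h (- x)) \<le> norm c * C" for x
  proof -
    have "(1 + norm x) ^ k * norm (c * h (- x)) = norm c * ((1 + norm (- x)) ^ k * norm (h (- x)))"
      by (simp add: norm_mult)
    also have "\<dots> \<le> norm c * C" by (intro mult_left_mono C) auto
    finally show ?thesis .
  qed
  then show "\<exists>C. \<forall>x. (1 + norm x) ^ k * norm (c * h (- x)) \<le> C" by blast
qed

text \<open>Inversion in the form in which it is applied: h itself becomes a forward transform, so
  the formulas for derivatives of transforms hold for h.\<close>

lemma eq_fourier_of_fourier:
  fixes h :: "real^'n \<Rightarrow> complex"
  assumes h: "rapid h" and fh: "rapid (fourier h)"
  shows "h = fourier (\<lambda>\<xi>. inverse (complex_of_real ((2 * pi) ^ CARD('n))) * fourier h (- \<xi>))"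
proof
  fix x
  let ?c = "complex_of_real ((2 * pi) ^ CARD('n))"
  have m: "(\<lambda>y. cis (- (y \<bullet> - x)) * fourier h y) \<in> borel_measurable borel"
    by (intro borel_measurable_times rapid_borel_measurable[OF fh] borel_measurable_continuous_onI continuous_intros)
  have "?c * h x = (LINT y|lborel. cis (- (y \<bullet> - x)) * fourier h y)"
    using fourier_inversion[OF h fh, of x] by (simp add: fourier_def[of "fourier h"])
  also have "\<dots> = (LINT y|lborel. cis (- (y \<bullet> x)) * fourier h (- y))"
    using lborel_integral_affine[OF _ m, of "-1" 0] by simp
  finally have "h x = inverse ?c * (LINT y|lborel. cis (- (y \<bullet> x)) * fourier h (- y))"
    by (simp add: field_simps)
  also have "\<dots> = (LINT y|lborel. inverse ?c * (cis (- (y \<bullet> x)) * fourier h (- y)))" by simp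
  also have "\<dots> = fourier (\<lambda>\<xi>. inverse ?c * fourier h (- \<xi>)) x"
    unfolding fourier_def[of "\<lambda>\<xi>. inverse ?c * fourier h (- \<xi>)"] by (simp only: mult.left_commute)
  finally show "h x = fourier (\<lambda>\<xi>. inverse ?c * fourier h (- \<xi>)) x" .
qed

section \<open>Derivatives of products\<close>

lemma smooth_has_partial_derivative:
  assumes "smooth f"
  shows "((\<lambda>t. iter_partial is f (x + t *\<^sub>R axis i 1)) has_vector_derivative iter_partial (i # is) f x) (at 0)"
  using assms unfolding smooth_def iter_partial_Cons partial_deriv_def
  by (simp add: vector_derivative_works[symmetric])

lemma smooth_continuous: "smooth f \<Longrightarrow> continuous_on UNIV (iter_partial is f)"
  by (simp add: smooth_def)

lemma iter_partial_lincomb: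
  assumes f: "smooth f" and g: "smooth g"
  shows "iter_partial is (\<lambda>x. a * f x + b * g x) = (\<lambda>x. a * iter_partial is f x + b * iter_partial is g x)"
proof (induction "is")
  case (Cons i "is")
  show ?case
    unfolding iter_partial_Cons[of _ _ "\<lambda>x. a * f x + b * g x"] Cons.IH
    unfolding partial_deriv_def[of _ "\<lambda>x. a * iter_partial is f x + b * iter_partial is g x"]
    by (intro ext vector_derivative_at has_vector_derivative_add has_vector_derivative_mult_right
        smooth_has_partial_derivative f g)
qed simp

lemma smooth_lincomb:
  assumes f: "smooth f" and g: "smooth g"
  shows "smooth (\<lambda>x. a * f x + b * g x)"
  unfolding smooth_def iter_partial_lincomb[OF assms]
proof (intro allI conjI)
  fix "is" i and x :: "real^'a"
  show "continuous_on UNIV (\<lambda>x. a * iter_partial is f x + b * iter_partial is g x)"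
    by (intro continuous_intros smooth_continuous f g)
  have "((\<lambda>t. a * iter_partial is f (x + t *\<^sub>R axis i 1) + b * iter_partial is g (x + t *\<^sub>R axis i 1))
      has_vector_derivative a * iter_partial (i # is) f x + b * iter_partial (i # is) g x) (at 0)"
    by (intro has_vector_derivative_add has_vector_derivative_mult_right smooth_has_partial_derivative f g)
  then show "(\<lambda>t. a * iter_partial is f (x + t *\<^sub>R axis i 1) + b * iter_partial is g (x + t *\<^sub>R axis i 1)) differentiable at 0"
    by (rule differentiableI_vector)
qed

section \<open>The Leibniz rule over lists of directions\<close>

text \<open>The distributions of the entries over the two factors of a product, listed with
  multiplicity. The Leibniz rule then has no binomial coefficients; their sum reappears as the
  number of summands.\<close>

fun splits :: "'a list \<Rightarrow> ('a list \<times> 'a list) list" where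
  "splits [] = [([], [])]"
| "splits (i # is) = map (\<lambda>(a, b). (i # a, b)) (splits is) @ map (\<lambda>(a, b). (a, i # b)) (splits is)"

lemma length_splits: "length (splits is) = 2 ^ length is"
  by (induction "is") auto

lemma splits_length: "(a, b) \<in> set (splits is) \<Longrightarrow> length a + length b = length is"
  by (induction "is" arbitrary: a b) auto

lemma has_vector_derivative_sum_list:
  assumes "\<And>p. p \<in> set L \<Longrightarrow> ((\<lambda>t. f p t) has_vector_derivative f' p) F"
  shows "((\<lambda>t. \<Sum>p\<leftarrow>L. f p t) has_vector_derivative (\<Sum>p\<leftarrow>L. f' p)) F"
  using assms by (induction L) (auto intro!: has_vector_derivative_add)

text \<open>A further derivative in direction i falls on either factor of each summand, which is the
  recursion of \<open>splits\<close>.\<close>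

lemma product_has_partial_derivative:
  assumes f: "smooth f" and g: "smooth g"
  shows "((\<lambda>t. \<Sum>(a, b)\<leftarrow>splits is. iter_partial a f (x + t *\<^sub>R axis i 1) * iter_partial b g (x + t *\<^sub>R axis i 1))
    has_vector_derivative (\<Sum>(a, b)\<leftarrow>splits (i # is). iter_partial a f x * iter_partial b g x)) (at 0)"
proof -
  have "((\<lambda>t. \<Sum>(a, b)\<leftarrow>splits is. iter_partial a f (x + t *\<^sub>R axis i 1) * iter_partial b g (x + t *\<^sub>R axis i 1))
    has_vector_derivative (\<Sum>p\<leftarrow>splits is. iter_partial (fst p) f x * iter_partial (i # snd p) g x
      + iter_partial (i # fst p) f x * iter_partial (snd p) g x)) (at 0)"
  proof (rule has_vector_derivative_sum_list)
    fix p assume "p \<in> set (splits is)"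
    have "((\<lambda>t. iter_partial (fst p) f (x + t *\<^sub>R axis i 1) * iter_partial (snd p) g (x + t *\<^sub>R axis i 1))
      has_vector_derivative iter_partial (fst p) f (x + 0 *\<^sub>R axis i 1) * iter_partial (i # snd p) g x
      + iter_partial (i # fst p) f x * iter_partial (snd p) g (x + 0 *\<^sub>R axis i 1)) (at 0)"
      by (intro has_vector_derivative_mult smooth_has_partial_derivative f g)
    then show "((\<lambda>t. case p of (a, b) \<Rightarrow> iter_partial a f (x + t *\<^sub>R axis i 1) * iter_partial b g (x + t *\<^sub>R axis i 1))
      has_vector_derivative iter_partial (fst p) f x * iter_partial (i # snd p) g x
      + iter_partial (i # fst p) f x * iter_partial (snd p) g x) (at 0)"
      by (simp add: case_prod_beta)
  qed
  then show ?thesis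
    by (simp add: sum_list_addf case_prod_beta o_def add.commute)
qed

lemma iter_partial_mult:
  assumes f: "smooth f" and g: "smooth g"
  shows "iter_partial is (\<lambda>x. f x * g x) = (\<lambda>x. \<Sum>(a, b)\<leftarrow>splits is. iter_partial a f x * iter_partial b g x)"
proof (induction "is")
  case (Cons i "is")
  show ?case
    unfolding iter_partial_Cons Cons.IH partial_deriv_def
    by (intro ext vector_derivative_at product_has_partial_derivative f g)
qed simp

lemma continuous_on_sum_list:
  fixes f :: "'p \<Rightarrow> 'a::topological_space \<Rightarrow> 'b::real_normed_vector"
  assumes "\<And>p. p \<in> set L \<Longrightarrow> continuous_on S (f p)"
  shows "continuous_on S (\<lambda>x. \<Sum>p\<leftarrow>L. f p x)"
  using assms by (induction L) (auto intro!: continuous_on_add)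

lemma smooth_mult:
  assumes f: "smooth f" and g: "smooth g"
  shows "smooth (\<lambda>x. f x * g x)"
  unfolding smooth_def iter_partial_mult[OF assms]
proof (intro allI conjI)
  fix "is"
  show "continuous_on UNIV (\<lambda>x. \<Sum>(a, b)\<leftarrow>splits is. iter_partial a f x * iter_partial b g x)"
    unfolding case_prod_beta
    by (intro continuous_on_sum_list continuous_on_mult smooth_continuous f g)
qed (rule differentiableI_vector[OF product_has_partial_derivative[OF f g]])

section \<open>Multi-indices and lists of directions\<close>

text \<open>The list picked by \<open>SOME\<close> depends on \<alpha> alone, so one list serves all
  f. It has the right counts because every finite multiset is the multiset of a list.\<close>

lemma multi_deriv_list:
  fixes \<alpha> :: "'n::finite \<Rightarrow> nat"
  obtains "is" where "\<And>f. multi_deriv \<alpha> f = iter_partial is f" "\<And>i. count_list is i = \<alpha> i"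
    "length is = multi_order \<alpha>"
proof -
  obtain xs where "mset xs = (\<Sum>i\<in>UNIV. replicate_mset (\<alpha> i) i)" using ex_mset by blast
  then have "count_list xs i = (\<Sum>j\<in>UNIV. count (replicate_mset (\<alpha> j) j) i)" for i
    by (metis count_mset count_sum)
  also have "(\<Sum>j\<in>UNIV. count (replicate_mset (\<alpha> j) j) i) = \<alpha> i" for i
    by simp
  finally have "\<forall>i. count_list xs i = \<alpha> i" by blast
  then have "\<forall>i. count_list (SOME is. \<forall>i. count_list is i = \<alpha> i) i = \<alpha> i" by (rule someI)
  moreover from this have "length (SOME is. \<forall>i. count_list is i = \<alpha> i) = multi_order \<alpha>"
    using sum_count_set[of "SOME is. \<forall>i. count_list is i = \<alpha> i" UNIV] by (simp add: multi_order_def)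
  ultimately show ?thesis using that[of "SOME is. \<forall>i. count_list is i = \<alpha> i"]
    by (simp add: multi_deriv_def)
qed

text \<open>The converse passage: the list picked for the counts of \<open>is\<close> is a
  permutation of \<open>is\<close>, so under symmetry every ordered derivative is a multi-index
  derivative.\<close>

lemma multi_deriv_count_list:
  assumes perm: "\<And>is js. mset is = mset js \<Longrightarrow> iter_partial is f = iter_partial js f"
  shows "multi_deriv (count_list is) f = iter_partial is f" "multi_order (count_list is) = length is"
proof -
  obtain js where js: "multi_deriv (count_list is) f = iter_partial js f" "\<And>i. count_list js i = count_list is i"
    "length js = multi_order (count_list is)"
    using multi_deriv_list[of "count_list is"] by metis
  have "mset js = mset is" by (rule multiset_eqI) (simp add: count_mset js)
  then show "multi_deriv (count_list is) f = iter_partial is f" "multi_order (count_list is) = length is"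
    using perm js by (metis, metis size_mset)
qed

lemma multi_deriv_zero: "multi_deriv (\<lambda>_. 0) f = f"
  using multi_deriv_list[of "\<lambda>_. 0"]
  by (metis iter_partial_Nil length_0_conv multi_order_def sum.neutral_const)

lemma sup_norm_finite_iff: "sup_norm g < \<infinity> \<longleftrightarrow> (\<exists>C. \<forall>x. norm (g x) \<le> C)"
proof
  assume fin: "sup_norm g < \<infinity>"
  have "norm (g x) \<le> enn2real (sup_norm g)" for x
  proof -
    have "ennreal (norm (g x)) \<le> sup_norm g" unfolding sup_norm_def by (rule SUP_upper) simp
    also have "\<dots> = ennreal (enn2real (sup_norm g))" using fin by simp
    finally show ?thesis by simp
  qed
  then show "\<exists>C. \<forall>x. norm (g x) \<le> C" by blast
next
  assume "\<exists>C. \<forall>x. norm (g x) \<le> C"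
  then obtain C where "\<And>x. norm (g x) \<le> C" by blast
  then have "sup_norm g \<le> ennreal C" unfolding sup_norm_def by (intro SUP_least ennreal_leI)
  then show "sup_norm g < \<infinity>" by (simp add: order_le_less_trans)
qed

lemma sup_norm_weighted_finite_iff:
  "sup_norm (weighted_deriv \<omega> \<mu> \<alpha> f) < \<infinity> \<longleftrightarrow> (\<exists>C. \<forall>x. exp (\<mu> * \<omega> (norm x)) * norm (multi_deriv \<alpha> f x) \<le> C)"
  unfolding sup_norm_finite_iff by (simp add: weighted_deriv_def)

definition decays :: "(real \<Rightarrow> real) \<Rightarrow> (real^'n \<Rightarrow> complex) \<Rightarrow> bool" where
  "decays \<omega> f \<longleftrightarrow> (\<forall>\<mu>>0. \<exists>C. \<forall>x. exp (\<mu> * \<omega> (norm x)) * norm (f x) \<le> C)"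

lemma S_omegaI:
  assumes "integrable lborel f" "smooth f" "smooth (fourier f)"
    and "\<And>is. decays \<omega> (iter_partial is f)" "\<And>is. decays \<omega> (iter_partial is (fourier f))"
  shows "f \<in> S_omega \<omega>"
  unfolding S_omega_def sup_norm_weighted_finite_iff
proof (intro CollectI conjI allI impI)
  fix \<mu> :: real and \<alpha> :: "'a \<Rightarrow> nat" assume \<mu>: "\<mu> > 0"
  obtain "is" where "\<And>f. multi_deriv \<alpha> f = iter_partial is f" using multi_deriv_list[of \<alpha>] by metis
  then show "\<exists>C. \<forall>x. exp (\<mu> * \<omega> (norm x)) * norm (multi_deriv \<alpha> f x) \<le> C"
    "\<exists>C. \<forall>x. exp (\<mu> * \<omega> (norm x)) * norm (multi_deriv \<alpha> (fourier f) x) \<le> C"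
    using assms(4,5) \<mu> by (simp_all add: decays_def)
qed (use assms in auto)


section \<open>The algebra\<close>

locale weight =
  fixes \<omega> :: "real \<Rightarrow> real"
  assumes weight: "nonquasianalytic_weight \<omega>" and normalized: "normalized_weight \<omega>"
begin

lemma nonneg: "t \<ge> 0 \<Longrightarrow> \<omega> t \<ge> 0"
  using weight by (simp add: nonquasianalytic_weight_def)

lemma mono: "0 \<le> s \<Longrightarrow> s \<le> t \<Longrightarrow> \<omega> s \<le> \<omega> t"
  using weight by (auto simp: nonquasianalytic_weight_def mono_on_def)

lemma at_one: "\<omega> 1 = 0"
  using normalized by (simp add: normalized_weight_def)

lemma one_le_exp: "\<mu> \<ge> 0 \<Longrightarrow> 1 \<le> exp (\<mu> * \<omega> (norm x))"
  by (simp add: nonneg)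

definition doubling_const where "doubling_const = (SOME K. K \<ge> 1 \<and> (\<forall>t\<ge>0. \<omega> (2 * t) \<le> K * (1 + \<omega> t)))"

lemma doubling_const: "doubling_const \<ge> 1" "t \<ge> 0 \<Longrightarrow> \<omega> (2 * t) \<le> doubling_const * (1 + \<omega> t)"
proof -
  have "\<exists>K. K \<ge> 1 \<and> (\<forall>t\<ge>0. \<omega> (2 * t) \<le> K * (1 + \<omega> t))"
    using weight by (auto simp: nonquasianalytic_weight_def)
  from someI_ex[OF this] show "doubling_const \<ge> 1" "t \<ge> 0 \<Longrightarrow> \<omega> (2 * t) \<le> doubling_const * (1 + \<omega> t)"
    unfolding doubling_const_def by blast+
qed

text \<open>A substitute for subadditivity: \<open>norm x\<close> is at most twice the larger of the
  two norms on the right. With \<open>x + y\<close> and y on the right, it fits the convolution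
  integral as it stands.\<close>

lemma add_le:
  fixes x y :: "'a::real_normed_vector"
  shows "\<omega> (norm x) \<le> doubling_const * (1 + \<omega> (norm (x + y)) + \<omega> (norm y))"
proof -
  define r where "r = max (norm (x + y)) (norm y)"
  have r: "r \<ge> 0" by (simp add: r_def le_max_iff_disj)
  have "norm x \<le> norm (x + y) + norm y" using norm_triangle_ineq4[of "x + y" y] by simp
  also have "\<dots> \<le> 2 * r" by (simp add: r_def)
  finally have "\<omega> (norm x) \<le> \<omega> (2 * r)" by (intro mono) auto
  also have "\<dots> \<le> doubling_const * (1 + \<omega> r)" by (rule doubling_const(2)[OF r])
  also have "\<dots> \<le> doubling_const * (1 + \<omega> (norm (x + y)) + \<omega> (norm y))"
    using doubling_const(1) nonneg[of "norm (x+y)"] nonneg[of "norm y"] by (intro mult_left_mono) (auto simp: r_def max_def)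
  finally show ?thesis .
qed

lemma power_le_exp:
  obtains \<mu> C where "\<mu> > 0" "C > 0" "\<And>t. t \<ge> 0 \<Longrightarrow> (1 + t) ^ k \<le> C * exp (\<mu> * \<omega> t)"
proof -
  obtain a b where ab: "b > 0" "\<And>t. t \<ge> 0 \<Longrightarrow> \<omega> t \<ge> a + b * ln (1 + t)"
    using weight by (auto simp: nonquasianalytic_weight_def)
  \<comment> \<open>\<open>Suc k\<close> instead of k keeps \<mu> positive when
    \<open>k = 0\<close>.\<close>
  define \<mu> where "\<mu> = real (Suc k) / b"
  have \<mu>: "\<mu> > 0" using ab by (simp add: \<mu>_def)
  have "(1 + t) ^ k \<le> exp (- (\<mu> * a)) * exp (\<mu> * \<omega> t)" if t: "t \<ge> 0" for t
  proof -
    have "(1 + t) ^ k = exp (real k * ln (1 + t))" using t by (simp add: exp_of_nat_mult)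
    moreover have "real k * ln (1 + t) \<le> \<mu> * (b * ln (1 + t))"
    proof -
      have "real k * ln (1 + t) \<le> (\<mu> * b) * ln (1 + t)"
        using ab t by (intro mult_right_mono) (auto simp: \<mu>_def)
      then show ?thesis by (simp only: mult.assoc)
    qed
    moreover have "\<mu> * (b * ln (1 + t)) \<le> \<mu> * (\<omega> t - a)"
      using ab(2)[OF t] \<mu> by (intro mult_left_mono) auto
    ultimately show ?thesis by (simp add: exp_add[symmetric] algebra_simps)
  qed
  then show ?thesis using that[of \<mu> "exp (- (\<mu> * a))"] \<mu> by auto
qed

text \<open>By condition (\<gamma>) a polynomial factor is paid for with a larger exponent
  \<open>\<mu> + \<nu>\<close>. This provides the integrable majorants of the later
  estimates.\<close>

lemma decays_poly:
  fixes f :: "real^'n \<Rightarrow> complex"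
  assumes f: "decays \<omega> f" and \<mu>: "\<mu> \<ge> 0"
  obtains C where "C > 0" "\<And>x. exp (\<mu> * \<omega> (norm x)) * norm (f x) \<le> C * inverse ((1 + norm x) ^ k)"
proof -
  obtain \<nu> C where \<nu>: "\<nu> > 0" "C > 0" "\<And>t. t \<ge> 0 \<Longrightarrow> (1 + t) ^ k \<le> C * exp (\<nu> * \<omega> t)"
    by (rule power_le_exp[of k]) (rule that)
  obtain B where B: "\<And>x. exp ((\<mu> + \<nu>) * \<omega> (norm x)) * norm (f x) \<le> B"
    using f \<mu> \<nu> unfolding decays_def by (metis add_nonneg_pos)
  have "exp (\<mu> * \<omega> (norm x)) * norm (f x) \<le> (C * (\<bar>B\<bar> + 1)) * inverse ((1 + norm x) ^ k)" for x
  proof -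
    have pos: "(1 + norm x) ^ k > 0" by (simp add: add_pos_nonneg)
    have "(1 + norm x) ^ k * (exp (\<mu> * \<omega> (norm x)) * norm (f x))
        \<le> (C * exp (\<nu> * \<omega> (norm x))) * (exp (\<mu> * \<omega> (norm x)) * norm (f x))"
      using \<nu>(3)[of "norm x"] by (intro mult_right_mono) auto
    also have "\<dots> = C * (exp ((\<mu> + \<nu>) * \<omega> (norm x)) * norm (f x))"
      by (simp add: exp_add distrib_right)
    also have "\<dots> \<le> C * (\<bar>B\<bar> + 1)" using B[of x] \<nu> by (intro mult_left_mono) auto
    finally show ?thesis using pos by (simp add: field_simps)
  qed
  then show ?thesis using that[of "C * (\<bar>B\<bar> + 1)"] \<nu> by (auto intro!: mult_pos_pos)
qed

lemma decays_rapid: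
  assumes "decays \<omega> f" "continuous_on UNIV f"
  shows "rapid f"
  unfolding rapid_def
proof (intro conjI allI)
  fix k
  obtain C where C: "\<And>x. exp (0 * \<omega> (norm x)) * norm (f x) \<le> C * inverse ((1 + norm x) ^ k)"
    using decays_poly[OF assms(1), of 0 k] by auto
  have "(1 + norm x) ^ k * norm (f x) \<le> C" for x
  proof -
    have pos: "(1 + norm x) ^ k > 0" by (simp add: add_pos_nonneg)
    then show ?thesis using C[of x] by (simp add: field_simps)
  qed
  then show "\<exists>C. \<forall>x. (1 + norm x) ^ k * norm (f x) \<le> C" by blast
qed (fact assms)

lemma S_omega_rapid:
  assumes "f \<in> S_omega \<omega>"
  shows "rapid f" "rapid (fourier f)" "decays \<omega> (fourier f)"
proof -
  have fin: "sup_norm (weighted_deriv \<omega> \<mu> \<alpha> f) < \<infinity> \<and> sup_norm (weighted_deriv \<omega> \<mu> \<alpha> (fourier f)) < \<infinity>"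
    if "\<mu> > 0" for \<mu> \<alpha>
    using assms that by (simp add: S_omega_def)
  note fin0 = fin[of _ "\<lambda>_. 0", unfolded sup_norm_weighted_finite_iff multi_deriv_zero]
  have 1: "decays \<omega> f" unfolding decays_def using fin0 by blast
  show 2: "decays \<omega> (fourier f)" unfolding decays_def using fin0 by blast
  have "smooth f" "smooth (fourier f)" using assms by (auto simp: S_omega_def)
  then have "continuous_on UNIV f" "continuous_on UNIV (fourier f)"
    using smooth_continuous[of _ "[]"] by auto
  then show "rapid f" "rapid (fourier f)" using 1 2 by (auto intro: decays_rapid)
qed

lemma S_omega_smooth: "f \<in> S_omega \<omega> \<Longrightarrow> smooth f"
  by (simp add: S_omega_def)

lemma S_omega_eq_fourier:
  fixes f :: "real^'n \<Rightarrow> complex"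
  assumes f: "f \<in> S_omega \<omega>"
  obtains h where "rapid h" "decays \<omega> h" "f = fourier h"
proof
  let ?c = "inverse (complex_of_real ((2 * pi) ^ CARD('n)))"
  let ?h = "\<lambda>\<xi>. ?c * fourier f (- \<xi>)"
  note R = S_omega_rapid[OF f]
  show "rapid ?h" by (rule rapid_reflect[OF R(2)])
  show "f = fourier ?h" by (rule eq_fourier_of_fourier[OF R(1,2)])
  show "decays \<omega> ?h"
    unfolding decays_def
  proof (intro allI impI)
    fix \<mu> :: real assume "\<mu> > 0"
    then obtain C where C: "\<And>x. exp (\<mu> * \<omega> (norm x)) * norm (fourier f x) \<le> C" using R(3) unfolding decays_def by blast
    have "exp (\<mu> * \<omega> (norm x)) * norm (?h x) \<le> norm ?c * C" for x
    proof -
      have "exp (\<mu> * \<omega> (norm x)) * norm (?h x) = norm ?c * (exp (\<mu> * \<omega> (norm (- x))) * norm (fourier f (- x)))"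
        by (simp add: norm_mult)
      also have "\<dots> \<le> norm ?c * C" by (intro mult_left_mono C) auto
      finally show ?thesis .
    qed
    then show "\<exists>C. \<forall>x. exp (\<mu> * \<omega> (norm x)) * norm (?h x) \<le> C" by blast
  qed
qed

lemma S_omega_perm:
  assumes "f \<in> S_omega \<omega>" "mset is = mset js"
  shows "iter_partial is f = iter_partial js f"
  using S_omega_eq_fourier[OF assms(1)] iter_partial_fourier_perm[OF _ assms(2)] by metis

lemma S_omega_decays:
  assumes f: "f \<in> S_omega \<omega>"
  shows "decays \<omega> (iter_partial is f)" "decays \<omega> (iter_partial is (fourier f))"
proof -
  have "multi_deriv (count_list is) f = iter_partial is f"
    by (rule multi_deriv_count_list(1)) (rule S_omega_perm[OF f])
  moreover have "multi_deriv (count_list is) (fourier f) = iter_partial is (fourier f)"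
    by (rule multi_deriv_count_list(1)) (rule iter_partial_fourier_perm[OF S_omega_rapid(1)[OF f]])
  ultimately show "decays \<omega> (iter_partial is f)" "decays \<omega> (iter_partial is (fourier f))"
    using f unfolding S_omega_def decays_def sup_norm_weighted_finite_iff mem_Collect_eq by metis+
qed

lemma decays_lincomb:
  assumes f: "decays \<omega> f" and g: "decays \<omega> g"
  shows "decays \<omega> (\<lambda>x. a * f x + b * g x)"
  unfolding decays_def
proof (intro allI impI)
  fix \<mu> :: real assume "\<mu> > 0"
  with f g obtain C D where C: "\<And>x. exp (\<mu> * \<omega> (norm x)) * norm (f x) \<le> C"
    and D: "\<And>x. exp (\<mu> * \<omega> (norm x)) * norm (g x) \<le> D" unfolding decays_def by blast
  have "exp (\<mu> * \<omega> (norm x)) * norm (a * f x + b * g x) \<le> norm a * C + norm b * D" for x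
  proof -
    have "exp (\<mu> * \<omega> (norm x)) * norm (a * f x + b * g x)
        \<le> exp (\<mu> * \<omega> (norm x)) * (norm a * norm (f x) + norm b * norm (g x))"
      using norm_triangle_ineq[of "a * f x" "b * g x"] by (intro mult_left_mono) (auto simp: norm_mult)
    also have "\<dots> = norm a * (exp (\<mu> * \<omega> (norm x)) * norm (f x)) + norm b * (exp (\<mu> * \<omega> (norm x)) * norm (g x))"
      by (simp add: algebra_simps)
    also have "\<dots> \<le> norm a * C + norm b * D" by (intro add_mono mult_left_mono C D) auto
    finally show ?thesis .
  qed
  then show "\<exists>C. \<forall>x. exp (\<mu> * \<omega> (norm x)) * norm (a * f x + b * g x) \<le> C" by blast
qed

lemma S_omega_lincomb:
  assumes f: "f \<in> S_omega \<omega>" and g: "g \<in> S_omega \<omega>"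
  shows "(\<lambda>x. a * f x + b * g x) \<in> S_omega \<omega>"
proof -
  have int: "integrable lborel f" "integrable lborel g" using f g by (auto simp: S_omega_def)
  have sm: "smooth (fourier f)" "smooth (fourier g)" using f g by (auto simp: S_omega_def)
  have F: "fourier (\<lambda>x. a * f x + b * g x) = (\<lambda>\<xi>. a * fourier f \<xi> + b * fourier g \<xi>)"
  proof
    fix \<xi>
    have "fourier (\<lambda>x. a * f x + b * g x) \<xi>
      = (LINT x|lborel. a * (cis (- (x \<bullet> \<xi>)) * f x) + b * (cis (- (x \<bullet> \<xi>)) * g x))"
      unfolding fourier_def by (simp add: algebra_simps)
    also have "\<dots> = a * fourier f \<xi> + b * fourier g \<xi>"
      unfolding fourier_def
      by (subst Bochner_Integration.integral_add)
        (simp_all only: integrable_mult_right[OF integrable_fourier_integrand] int integral_mult_right_zero)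
    finally show "fourier (\<lambda>x. a * f x + b * g x) \<xi> = a * fourier f \<xi> + b * fourier g \<xi>" .
  qed
  show ?thesis
  proof (rule S_omegaI)
    show "integrable lborel (\<lambda>x. a * f x + b * g x)" using int by simp
    show "smooth (\<lambda>x. a * f x + b * g x)" by (intro smooth_lincomb S_omega_smooth f g)
    show "smooth (fourier (\<lambda>x. a * f x + b * g x))" unfolding F by (intro smooth_lincomb sm)
    fix "is"
    show "decays \<omega> (iter_partial is (\<lambda>x. a * f x + b * g x))"
      unfolding iter_partial_lincomb[OF S_omega_smooth[OF f] S_omega_smooth[OF g]]
      by (intro decays_lincomb S_omega_decays f g)
    show "decays \<omega> (iter_partial is (fourier (\<lambda>x. a * f x + b * g x)))"
      unfolding F iter_partial_lincomb[OF sm] by (intro decays_lincomb S_omega_decays f g)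
  qed
qed

lemma decays_mult:
  assumes f: "decays \<omega> f" and g: "decays \<omega> g"
  shows "decays \<omega> (\<lambda>x. f x * g x)"
  unfolding decays_def
proof (intro allI impI)
  fix \<mu> :: real assume \<mu>: "\<mu> > 0"
  with f g obtain C D where C: "\<And>x. exp (\<mu> * \<omega> (norm x)) * norm (f x) \<le> C"
    and D: "\<And>x. exp (\<mu> * \<omega> (norm x)) * norm (g x) \<le> D" unfolding decays_def by blast
  have "exp (\<mu> * \<omega> (norm x)) * norm (f x * g x) \<le> C * D" for x
  proof -
    have "norm (g x) \<le> exp (\<mu> * \<omega> (norm x)) * norm (g x)"
      using one_le_exp[of \<mu> x] \<mu> by (simp add: mult_le_cancel_right1)
    then have "norm (g x) \<le> D" using D[of x] by linarith
    moreover have "0 \<le> C" by (rule order.trans[OF _ C[of x]]) simp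
    ultimately have "(exp (\<mu> * \<omega> (norm x)) * norm (f x)) * norm (g x) \<le> C * D"
      by (intro mult_mono C) auto
    then show ?thesis by (simp add: norm_mult mult.assoc)
  qed
  then show "\<exists>C. \<forall>x. exp (\<mu> * \<omega> (norm x)) * norm (f x * g x) \<le> C" by blast
qed

lemma decays_sum_list:
  "(\<And>p. p \<in> set L \<Longrightarrow> decays \<omega> (f p)) \<Longrightarrow> decays \<omega> (\<lambda>x. \<Sum>p\<leftarrow>L. f p x)"
proof (induction L)
  case Nil
  show ?case by (auto simp: decays_def)
next
  case (Cons p L)
  then show ?case using decays_lincomb[of "f p" "\<lambda>x. \<Sum>p\<leftarrow>L. f p x" 1 1] by simp
qed

section \<open>Closure under products\<close>

lemma S_omega_mult:
  fixes f g :: "real^'n \<Rightarrow> complex"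
  assumes f: "f \<in> S_omega \<omega>" and g: "g \<in> S_omega \<omega>"
  shows "(\<lambda>x. f x * g x) \<in> S_omega \<omega>"
proof (rule S_omegaI)
  obtain B where B: "\<And>x. norm (f x) \<le> B * inverse ((1 + norm x) ^ 0)"
    using rapidE[OF S_omega_rapid(1)[OF f]] by blast
  have R: "rapid (\<lambda>x. f x * g x)"
    by (rule rapid_mult_poly_bounded[OF S_omega_rapid(1)[OF g] rapid_continuous[OF S_omega_rapid(1)[OF f]], of B 0])
      (use B in simp)
  show "integrable lborel (\<lambda>x. f x * g x)" by (rule rapid_integrable[OF R])
  show "smooth (\<lambda>x. f x * g x)" by (intro smooth_mult S_omega_smooth f g)
  show "smooth (fourier (\<lambda>x. f x * g x))" by (rule smooth_fourier[OF R])
  fix "is"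
  show "decays \<omega> (iter_partial is (\<lambda>x. f x * g x))"
    unfolding iter_partial_mult[OF S_omega_smooth[OF f] S_omega_smooth[OF g]] case_prod_beta
    by (intro decays_sum_list decays_mult S_omega_decays f g)
  \<comment> \<open>The monomial that comes from differentiating the transform is attached to f. All
    derivatives then fall on \<open>fourier f\<close>, whose decay is known, and g enters only
    through h.\<close>
  define F where "F x = (\<Prod>i\<leftarrow>is. - \<i> * complex_of_real (x $ i)) * f x" for x
  have F: "rapid F" unfolding F_def by (rule rapid_monomial[OF S_omega_rapid(1)[OF f]])
  have FF: "fourier F = iter_partial is (fourier f)"
    unfolding F_def by (rule iter_partial_fourier[OF S_omega_rapid(1)[OF f], symmetric])
  obtain h where h: "rapid h" "decays \<omega> h" "g = fourier h" by (rule S_omega_eq_fourier[OF g]) (rule that)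
  have conv: "iter_partial is (fourier (\<lambda>x. f x * g x)) \<xi> = (LINT \<eta>|lborel. h \<eta> * fourier F (\<xi> + \<eta>))" for \<xi>
  proof -
    have "iter_partial is (fourier (\<lambda>x. f x * g x)) = fourier (\<lambda>x. F x * fourier h x)"
      unfolding h(3)[symmetric] iter_partial_fourier[OF R] F_def by (simp add: mult.assoc)
    then show ?thesis by (simp add: fourier_mult_fourier rapid_integrable F h(1))
  qed
  show "decays \<omega> (iter_partial is (fourier (\<lambda>x. f x * g x)))"
    unfolding decays_def
  proof (intro allI impI)
    fix \<mu> :: real assume \<mu>: "\<mu> > 0"
    \<comment> \<open>The rate \<open>\<mu> * doubling_const\<close> is what \<open>add_le\<close>
      leaves for each of the two factors under the integral; h has decay to spare, which makes the
      integral converge.\<close>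
    then have \<mu>_doubling: "\<mu> * doubling_const > 0" using doubling_const by simp
    then obtain B where B: "\<And>x. exp (\<mu> * doubling_const * \<omega> (norm x)) * norm (fourier F x) \<le> B"
      using S_omega_decays(2)[OF f, of "is"] unfolding FF[symmetric] decays_def by blast
    obtain C where C: "C > 0" "\<And>x. exp (\<mu> * doubling_const * \<omega> (norm x)) * norm (h x) \<le> C * inverse ((1 + norm x) ^ (2 * CARD('n)))"
      using decays_poly[OF h(2), of "\<mu> * doubling_const"] \<mu>_doubling by (metis less_imp_le)
    define I where "I = (LINT x|lborel. inverse ((1 + norm (x::real^'n)) ^ (2 * CARD('n))))"
    have "exp (\<mu> * \<omega> (norm \<xi>)) * norm (iter_partial is (fourier (\<lambda>x. f x * g x)) \<xi>) \<le> exp (\<mu> * doubling_const) * B * C * I" for \<xi>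
    proof -
      have "norm (exp (\<mu> * \<omega> (norm \<xi>)) *\<^sub>R (LINT \<eta>|lborel. h \<eta> * fourier F (\<xi> + \<eta>)))
          = norm (LINT \<eta>|lborel. exp (\<mu> * \<omega> (norm \<xi>)) *\<^sub>R (h \<eta> * fourier F (\<xi> + \<eta>)))" by simp
      also have "\<dots> \<le> (LINT \<eta>|lborel. exp (\<mu> * doubling_const) * B * C * inverse ((1 + norm (\<eta>::real^'n)) ^ (2 * CARD('n))))"
      proof (rule Bochner_Integration.integral_norm_bound_integral)
        have "continuous_on UNIV (\<lambda>\<eta>. fourier F (\<xi> + \<eta>))"
          by (rule continuous_on_compose2[OF continuous_fourier[OF F]]) (auto intro!: continuous_intros)
        moreover have "norm (fourier F (\<xi> + \<eta>)) \<le> B" for \<eta>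
        proof -
          have "norm (fourier F (\<xi> + \<eta>)) \<le> exp (\<mu> * doubling_const * \<omega> (norm (\<xi> + \<eta>))) * norm (fourier F (\<xi> + \<eta>))"
            using one_le_exp[of "\<mu> * doubling_const" "\<xi> + \<eta>"] \<mu>_doubling by (simp add: mult_le_cancel_right1)
          then show ?thesis using B[of "\<xi> + \<eta>"] by linarith
        qed
        ultimately have "rapid (\<lambda>\<eta>. fourier F (\<xi> + \<eta>) * h \<eta>)"
          by (intro rapid_mult_poly_bounded[OF h(1), of _ B 0]) auto
        then have "integrable lborel (\<lambda>\<eta>. h \<eta> * fourier F (\<xi> + \<eta>))"
          by (subst mult.commute) (rule rapid_integrable)
        then show "integrable lborel (\<lambda>\<eta>. exp (\<mu> * \<omega> (norm \<xi>)) *\<^sub>R (h \<eta> * fourier F (\<xi> + \<eta>)))"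
          by (rule integrable_scaleR_right)
        show "integrable lborel (\<lambda>\<eta>::real^'n. exp (\<mu> * doubling_const) * B * C * inverse ((1 + norm \<eta>) ^ (2 * CARD('n))))"
          by (intro integrable_mult_right integrable_inverse_one_plus_norm_power)
        fix \<eta> :: "real^'n"
        have "\<mu> * \<omega> (norm \<xi>) \<le> \<mu> * (doubling_const * (1 + \<omega> (norm (\<xi> + \<eta>)) + \<omega> (norm \<eta>)))"
          using \<mu> by (intro mult_left_mono add_le) auto
        then have "exp (\<mu> * \<omega> (norm \<xi>)) \<le> exp (\<mu> * doubling_const) * exp (\<mu> * doubling_const * \<omega> (norm (\<xi> + \<eta>))) * exp (\<mu> * doubling_const * \<omega> (norm \<eta>))"
          by (simp add: exp_add[symmetric] algebra_simps)
        then have "norm (exp (\<mu> * \<omega> (norm \<xi>)) *\<^sub>R (h \<eta> * fourier F (\<xi> + \<eta>)))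
          \<le> exp (\<mu> * doubling_const) * exp (\<mu> * doubling_const * \<omega> (norm (\<xi> + \<eta>))) * exp (\<mu> * doubling_const * \<omega> (norm \<eta>)) * (norm (h \<eta>) * norm (fourier F (\<xi> + \<eta>)))"
          by (simp add: norm_mult mult_right_mono)
        also have "\<dots> = exp (\<mu> * doubling_const) * ((exp (\<mu> * doubling_const * \<omega> (norm (\<xi> + \<eta>))) * norm (fourier F (\<xi> + \<eta>))) * (exp (\<mu> * doubling_const * \<omega> (norm \<eta>)) * norm (h \<eta>)))"
          by (simp only: mult_ac)
        also have "\<dots> \<le> exp (\<mu> * doubling_const) * (B * (C * inverse ((1 + norm \<eta>) ^ (2 * CARD('n)))))"
        proof -
          have "0 \<le> B" by (rule order.trans[OF _ B[of 0]]) simp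
          then show ?thesis by (intro mult_left_mono mult_mono B C) auto
        qed
        finally show "norm (exp (\<mu> * \<omega> (norm \<xi>)) *\<^sub>R (h \<eta> * fourier F (\<xi> + \<eta>))) \<le> exp (\<mu> * doubling_const) * B * C * inverse ((1 + norm \<eta>) ^ (2 * CARD('n)))"
          by (simp only: mult.assoc)
      qed
      also have "\<dots> = exp (\<mu> * doubling_const) * B * C * I" by (simp add: I_def)
      finally show ?thesis by (simp add: conv)
    qed
    then show "\<exists>C. \<forall>x. exp (\<mu> * \<omega> (norm x)) * norm (iter_partial is (fourier (\<lambda>x. f x * g x)) x) \<le> C" by blast
  qed
qed

end

section \<open>Finiteness of the norms and joint continuity\<close>

text \<open>Smoothness gives the derivative only at parameter 0, so the base point is moved along
  the ray; the factor s comes from the chain rule.\<close>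

lemma iter_partial_ray_derivative:
  assumes f: "smooth f"
  shows "((\<lambda>t. iter_partial is f (x + (t * s) *\<^sub>R axis i 1)) has_vector_derivative
    s *\<^sub>R iter_partial (i # is) f (x + (t\<^sub>0 * s) *\<^sub>R axis i 1)) (at t\<^sub>0)"
proof -
  let ?G = "\<lambda>u. iter_partial is f ((x + (t\<^sub>0 * s) *\<^sub>R axis i 1) + u *\<^sub>R axis i 1)"
  have "((\<lambda>t. (t - t\<^sub>0) * s) has_vector_derivative s) (at t\<^sub>0)"
    unfolding has_real_derivative_iff_has_vector_derivative[symmetric]
    by (auto intro!: derivative_eq_intros)
  moreover have "(?G has_vector_derivative iter_partial (i # is) f (x + (t\<^sub>0 * s) *\<^sub>R axis i 1)) (at ((t\<^sub>0 - t\<^sub>0) * s))"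
    using smooth_has_partial_derivative[OF f] by simp
  ultimately have "((?G \<circ> (\<lambda>t. (t - t\<^sub>0) * s)) has_vector_derivative
      s *\<^sub>R iter_partial (i # is) f (x + (t\<^sub>0 * s) *\<^sub>R axis i 1)) (at t\<^sub>0)"
    by (rule vector_diff_chain_at)
  moreover have "?G \<circ> (\<lambda>t. (t - t\<^sub>0) * s) = (\<lambda>t. iter_partial is f (x + (t * s) *\<^sub>R axis i 1))"
    by (simp add: fun_eq_iff algebra_simps flip: scaleR_add_left)
  ultimately show ?thesis by simp
qed

text \<open>Since s has the sign of the i-th coordinate, the cross term in the square of the norm on
  the right is nonnegative.\<close>

lemma norm_le_outward_ray:
  fixes x :: "real^'n"
  assumes "t \<ge> 0" "s = (if x $ i \<ge> 0 then 1 else -1)"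
  shows "norm x \<le> norm (x + (t * s) *\<^sub>R axis i 1)"
proof -
  have "x \<bullet> x + 2 * (t * (s * x $ i)) + (t * s)\<^sup>2 = (x + (t * s) *\<^sub>R axis i 1) \<bullet> (x + (t * s) *\<^sub>R axis i 1)"
    by (simp add: inner_add_left inner_add_right inner_axis inner_axis' power2_eq_square inner_axis_axis algebra_simps)
  moreover have "0 \<le> t * (s * x $ i)" using assms by (auto intro!: mult_nonneg_nonneg)
  ultimately show ?thesis unfolding norm_le by (smt (verit) zero_le_power2)
qed

text \<open>Bounds are required only at points at least as far from the origin as x; the outward ray
  consists of such points, and there the weight is no smaller than at x.\<close>

lemma iter_partial_interpolation:
  fixes f :: "real^'n \<Rightarrow> complex"
  assumes f: "smooth f"
    and A: "\<And>y. norm x \<le> norm y \<Longrightarrow> norm (iter_partial is f y) \<le> A"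
    and B: "\<And>y. norm x \<le> norm y \<Longrightarrow> norm (iter_partial (replicate (2 * k) i @ is) f y) \<le> B"
  shows "(norm (iter_partial (replicate k i @ is) f x))\<^sup>2 \<le> 4 * 576 ^ (2 * k) * A * B"
proof -
  define s :: real where "s = (if x $ i \<ge> 0 then 1 else -1)"
  have s: "\<bar>s\<bar> = 1" by (simp add: s_def)
  \<comment> \<open>The factor \<open>s ^ j\<close>, of modulus 1, makes these functions successive
    derivatives along the ray.\<close>
  define D where "D j t = s ^ j *\<^sub>R iter_partial (replicate j i @ is) f (x + (t * s) *\<^sub>R axis i 1)" for j t
  have "(norm (D k 0))\<^sup>2 \<le> 4 * 576 ^ (2 * k) * A * B"
  proof (rule landau_kolmogorov)
    fix j and t :: real assume t: "t \<ge> 0"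
    show "(D j has_vector_derivative D (Suc j) t) (at t)"
      using bounded_linear.has_vector_derivative[OF bounded_linear_scaleR_right iter_partial_ray_derivative[OF f, of "replicate j i @ is" x s i t], of "s ^ j"]
      unfolding D_def by (simp add: mult.commute)
    show "norm (D 0 t) \<le> A"
      using A[OF norm_le_outward_ray[OF t s_def]] by (simp add: D_def)
    show "norm (D (2 * k) t) \<le> B"
      using B[OF norm_le_outward_ray[OF t s_def]] by (simp add: D_def power_abs s)
  qed
  then show ?thesis by (simp add: D_def power_abs s)
qed

context weight
begin

abbreviation "W \<equiv> young_weight \<omega>"

section \<open>Real bounds corresponding to the norms\<close>

text \<open>The real form of a bound on \<open>q_norm\<close>, over lists, on which the Leibniz rule
  and the splitting by coordinates operate. The parameters are real because the doubling constant,
  which changes them, is real.\<close>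

definition q_bounded :: "real \<Rightarrow> real \<Rightarrow> (real^'n \<Rightarrow> complex) \<Rightarrow> real \<Rightarrow> bool" where
  "q_bounded m \<mu> f C \<longleftrightarrow>
    (\<forall>is x. exp (\<mu> * \<omega> (norm x)) * norm (iter_partial is f x) * W m (length is) \<le> C)"

lemma q_boundedD:
  "q_bounded m \<mu> f C \<Longrightarrow> exp (\<mu> * \<omega> (norm x)) * norm (iter_partial is f x) * W m (length is) \<le> C"
  by (simp add: q_bounded_def)

lemma q_bounded_nonneg: "q_bounded m \<mu> f C \<Longrightarrow> 0 \<le> C"
  by (rule order.trans[OF _ q_boundedD[of m \<mu> f C 0 "[]"]]) (simp add: young_weight_nonneg)

lemma q_norm_eq:
  assumes "m \<ge> 1"
  shows "q_norm \<omega> m n f = (SUP \<alpha>. sup_norm (weighted_deriv \<omega> (real n) \<alpha> f) * ennreal (W (real m) (multi_order \<alpha>)))"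
  unfolding q_norm_def using exp_ereal_young_conjugate[of "real m" \<omega>] assms by simp

lemma q_norm_le:
  assumes m: "m \<ge> 1" and b: "q_bounded (real m) (real n) f C"
  shows "q_norm \<omega> m n f \<le> ennreal C"
  unfolding q_norm_eq[OF m]
proof (rule SUP_least)
  fix \<alpha> :: "'a \<Rightarrow> nat"
  obtain "is" where deriv: "\<And>f. multi_deriv \<alpha> f = iter_partial is f" "length is = multi_order \<alpha>"
    using multi_deriv_list[of \<alpha>] by metis
  have "sup_norm (weighted_deriv \<omega> (real n) \<alpha> f) * ennreal (W (real m) (multi_order \<alpha>))
      = (SUP x. ennreal (norm (weighted_deriv \<omega> (real n) \<alpha> f x)) * ennreal (W (real m) (multi_order \<alpha>)))"
    unfolding sup_norm_def by (rule SUP_mult_right_ennreal)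
  also have "\<dots> \<le> ennreal C"
  proof (rule SUP_least)
    fix x
    have "norm (weighted_deriv \<omega> (real n) \<alpha> f x) * W (real m) (multi_order \<alpha>) \<le> C"
      using q_boundedD[OF b, of x "is"] deriv by (simp add: weighted_deriv_def)
    then show "ennreal (norm (weighted_deriv \<omega> (real n) \<alpha> f x)) * ennreal (W (real m) (multi_order \<alpha>)) \<le> ennreal C"
      by (simp add: ennreal_mult[symmetric] young_weight_nonneg ennreal_leI)
  qed
  finally show "sup_norm (weighted_deriv \<omega> (real n) \<alpha> f) * ennreal (W (real m) (multi_order \<alpha>)) \<le> ennreal C" .
qed

text \<open>Membership of f in the space enters through the symmetry of derivatives: it lets the
  multi-indices control all ordered lists.\<close>

lemma q_bounded_of_q_norm:
  assumes m: "m \<ge> 1" and f: "f \<in> S_omega \<omega>" and le: "q_norm \<omega> m n f \<le> ennreal C" and C: "C \<ge> 0"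
  shows "q_bounded (real m) (real n) f C"
  unfolding q_bounded_def
proof (intro allI)
  fix "is" x
  note c = multi_deriv_count_list[of f "is", OF S_omega_perm[OF f]]
  have "ennreal (norm (weighted_deriv \<omega> (real n) (count_list is) f x)) \<le> sup_norm (weighted_deriv \<omega> (real n) (count_list is) f)"
    unfolding sup_norm_def by (rule SUP_upper) simp
  then have "ennreal (norm (weighted_deriv \<omega> (real n) (count_list is) f x)) * ennreal (W (real m) (multi_order (count_list is)))
    \<le> sup_norm (weighted_deriv \<omega> (real n) (count_list is) f) * ennreal (W (real m) (multi_order (count_list is)))"
    by (rule mult_right_mono) simp
  also have "\<dots> \<le> q_norm \<omega> m n f" unfolding q_norm_eq[OF m] by (rule SUP_upper) simp
  also note le
  finally have "norm (weighted_deriv \<omega> (real n) (count_list is) f x) * W (real m) (multi_order (count_list is)) \<le> C"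
    using C by (simp add: ennreal_mult[symmetric] young_weight_nonneg)
  then show "exp (real n * \<omega> (norm x)) * norm (iter_partial is f x) * W (real m) (length is) \<le> C"
    by (simp add: weighted_deriv_def c)
qed

lemma q_bounded_add:
  assumes "smooth f" "smooth g" "q_bounded m \<mu> f A" "q_bounded m \<mu> g B"
  shows "q_bounded m \<mu> (\<lambda>x. f x + g x) (A + B)"
  unfolding q_bounded_def
proof (intro allI)
  fix "is" x
  have "iter_partial is (\<lambda>x. f x + g x) x = iter_partial is f x + iter_partial is g x"
    using iter_partial_lincomb[OF assms(1,2), of "is" 1 1] by simp
  then have "exp (\<mu> * \<omega> (norm x)) * norm (iter_partial is (\<lambda>x. f x + g x) x) * W m (length is)
      \<le> exp (\<mu> * \<omega> (norm x)) * (norm (iter_partial is f x) + norm (iter_partial is g x)) * W m (length is)"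
    by (intro mult_right_mono mult_left_mono young_weight_nonneg) (auto intro: norm_triangle_ineq)
  also have "\<dots> \<le> A + B"
    using add_mono[OF q_boundedD[OF assms(3), of x "is"] q_boundedD[OF assms(4), of x "is"]]
    by (simp add: algebra_simps)
  finally show "exp (\<mu> * \<omega> (norm x)) * norm (iter_partial is (\<lambda>x. f x + g x) x) * W m (length is) \<le> A + B" .
qed

text \<open>Each of the \<open>2 ^ k\<close> summands of the Leibniz rule is at most
  \<open>A * B\<close>: the Young weight splits by submultiplicativity, and the exponential factor
  may be doubled because it is at least 1. Then E and m' absorb \<open>2 ^ k\<close>.\<close>

lemma q_bounded_mult:
  fixes f g :: "real^'n \<Rightarrow> complex"
  assumes m: "m > 0" and f: "smooth f" and g: "smooth g" and \<mu>: "\<mu> \<ge> 0"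
    and E: "\<And>k. 2 ^ k * W m k \<le> E * W m' k" "E > 0" and m': "m' \<ge> 0"
    and A: "q_bounded m' \<mu> f A" and B: "q_bounded m' \<mu> g B"
  shows "q_bounded m \<mu> (\<lambda>x. f x * g x) (E * (A * B))"
  unfolding q_bounded_def
proof (intro allI)
  fix "is" :: "'n list" and x :: "real^'n"
  define e where "e = exp (\<mu> * \<omega> (norm x))"
  have e: "e \<ge> 1" unfolding e_def by (rule one_le_exp[OF \<mu>])
  let ?k = "length is"
  have summand: "e * norm (iter_partial a f x * iter_partial b g x) * W m' ?k \<le> A * B"
    if "(a, b) \<in> set (splits is)" for a b
  proof -
    have k: "?k = length a + length b" using splits_length[OF that] by simp
    have "e * norm (iter_partial a f x * iter_partial b g x) * W m' ?k
        \<le> (e * e) * norm (iter_partial a f x * iter_partial b g x) * (W m' (length a) * W m' (length b))"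
      unfolding k using e m'
      by (intro mult_mono young_weight_add nonneg young_weight_nonneg mult_nonneg_nonneg) auto
    also have "\<dots> = (e * norm (iter_partial a f x) * W m' (length a)) * (e * norm (iter_partial b g x) * W m' (length b))"
      by (simp only: norm_mult mult_ac)
    also have "\<dots> \<le> A * B"
      using q_boundedD[OF A, of x a] q_boundedD[OF B, of x b] q_bounded_nonneg[OF A] e unfolding e_def[symmetric]
      by (intro mult_mono) (auto intro!: mult_nonneg_nonneg young_weight_nonneg)
    finally show ?thesis .
  qed
  have "e * norm (iter_partial is (\<lambda>x. f x * g x) x) * W m' ?k
    \<le> e * (\<Sum>(a, b)\<leftarrow>splits is. norm (iter_partial a f x * iter_partial b g x)) * W m' ?k"
  proof -
    have "norm (\<Sum>p\<leftarrow>L. h p) \<le> (\<Sum>p\<leftarrow>L. norm (h p))" for L and h :: "'n list \<times> 'n list \<Rightarrow> complex"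
      by (induction L) (auto intro: norm_triangle_le)
    from this[of "\<lambda>(a, b). iter_partial a f x * iter_partial b g x" "splits is"]
    have "norm (iter_partial is (\<lambda>x. f x * g x) x) \<le> (\<Sum>(a, b)\<leftarrow>splits is. norm (iter_partial a f x * iter_partial b g x))"
      unfolding iter_partial_mult[OF f g] by (simp add: split_beta')
    then show ?thesis using e by (intro mult_right_mono mult_left_mono young_weight_nonneg) auto
  qed
  also have "\<dots> = (\<Sum>(a, b)\<leftarrow>splits is. e * norm (iter_partial a f x * iter_partial b g x) * W m' ?k)"
    by (simp only: sum_list_const_mult sum_list_mult_const split_beta')
  also have "\<dots> \<le> (\<Sum>p\<leftarrow>splits is. A * B)"
    using summand by (intro sum_list_mono) auto
  also have "\<dots> = 2 ^ ?k * (A * B)" by (simp add: sum_list_triv length_splits)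
  finally have 1: "e * norm (iter_partial is (\<lambda>x. f x * g x) x) * W m' ?k \<le> 2 ^ ?k * (A * B)" .
  have "2 ^ ?k * (e * norm (iter_partial is (\<lambda>x. f x * g x) x) * W m ?k)
      = (e * norm (iter_partial is (\<lambda>x. f x * g x) x)) * (2 ^ ?k * W m ?k)" by simp
  also have "\<dots> \<le> (e * norm (iter_partial is (\<lambda>x. f x * g x) x)) * (E * W m' ?k)"
    using e by (intro mult_left_mono E) auto
  also have "\<dots> = E * (e * norm (iter_partial is (\<lambda>x. f x * g x) x) * W m' ?k)" by simp
  also have "\<dots> \<le> E * (2 ^ ?k * (A * B))" using 1 E by (intro mult_left_mono) auto
  also have "\<dots> = 2 ^ ?k * (E * (A * B))" by simp
  finally show "e * norm (iter_partial is (\<lambda>x. f x * g x) x) * W m ?k \<le> E * (A * B)" by simp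
qed

section \<open>Finiteness of the norms\<close>

text \<open>A derivative of order k of \<open>fourier h\<close> is bounded by the integral of
  \<open>norm \<xi> ^ k * norm (h \<xi>)\<close>. The Young weight turns the power into
  \<open>exp (m * \<omega> (norm \<xi>))\<close>, which the decay of h absorbs with a constant
  independent of k.\<close>

lemma q_bounded_zero_weight:
  assumes f: "f \<in> S_omega \<omega>" and m: "m \<ge> 0"
  obtains C where "q_bounded m 0 f C"
proof -
  obtain h where h: "rapid h" "decays \<omega> h" "f = fourier h" by (rule S_omega_eq_fourier[OF f]) (rule that)
  obtain C where C: "C > 0" "\<And>x. exp (m * \<omega> (norm x)) * norm (h x) \<le> C * inverse ((1 + norm x) ^ (2 * CARD('a)))"
    using decays_poly[OF h(2) m] by metis
  define I where "I = (LINT x|lborel. C * inverse ((1 + norm (x::real^'a)) ^ (2 * CARD('a))))"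
  have "exp (0 * \<omega> (norm x)) * norm (iter_partial is f x) * W m (length is) \<le> I" for "is" x
  proof -
    let ?M = "\<lambda>\<xi>::real^'a. (\<Prod>i\<leftarrow>is. - \<i> * complex_of_real (\<xi> $ i))"
    have M: "norm (?M \<xi>) \<le> norm \<xi> ^ length is" for \<xi>
    proof (induction "is")
      case (Cons i "is")
      have "norm (- \<i> * complex_of_real (\<xi> $ i)) \<le> norm \<xi>"
        using component_le_norm_cart[of \<xi> i] by (simp add: norm_mult)
      from mult_mono[OF this Cons.IH] show ?case by (simp add: norm_mult)
    qed simp
    have R: "rapid (\<lambda>\<xi>. ?M \<xi> * h \<xi>)" by (rule rapid_monomial[OF h(1)])
    have "norm (iter_partial is f x) \<le> (LINT \<xi>|lborel. norm (?M \<xi> * h \<xi>))"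
      unfolding h(3) iter_partial_fourier[OF h(1)] by (rule norm_fourier_le)
    then have "norm (iter_partial is f x) * W m (length is) \<le> (LINT \<xi>|lborel. norm (?M \<xi> * h \<xi>)) * W m (length is)"
      by (intro mult_right_mono young_weight_nonneg)
    also have "\<dots> = (LINT \<xi>|lborel. norm (?M \<xi> * h \<xi>) * W m (length is))" by simp
    also have "\<dots> \<le> I" unfolding I_def
    proof (rule integral_mono)
      show "integrable lborel (\<lambda>\<xi>. norm (?M \<xi> * h \<xi>) * W m (length is))"
        by (intro integrable_mult_left integrable_norm rapid_integrable R)
      show "integrable lborel (\<lambda>x::real^'a. C * inverse ((1 + norm x) ^ (2 * CARD('a))))"
        by (intro integrable_mult_right integrable_inverse_one_plus_norm_power)
      fix \<xi> :: "real^'a"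
      have "norm (?M \<xi> * h \<xi>) * W m (length is) \<le> (norm \<xi> ^ length is * norm (h \<xi>)) * W m (length is)"
        unfolding norm_mult by (intro mult_right_mono young_weight_nonneg M) auto
      also have "\<dots> = (norm \<xi> ^ length is * W m (length is)) * norm (h \<xi>)" by simp
      also have "\<dots> \<le> exp (m * \<omega> (norm \<xi>)) * norm (h \<xi>)"
        by (intro mult_right_mono power_mult_young_weight_le nonneg at_one m) auto
      also have "\<dots> \<le> C * inverse ((1 + norm \<xi>) ^ (2 * CARD('a)))" by (rule C)
      finally show "norm (?M \<xi> * h \<xi>) * W m (length is) \<le> C * inverse ((1 + norm \<xi>) ^ (2 * CARD('a)))" .
    qed
    finally show ?thesis by simp
  qed
  then show ?thesis using that[of I] by (simp add: q_bounded_def)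
qed

text \<open>Induction on the set of coordinates that may occur. For a new coordinate i, the
  derivatives in the old ones decay by the induction hypothesis, those with the order in i doubled
  are bounded without weight, and interpolation keeps half of the decay. Hence the hypothesis is
  used with both parameters doubled.\<close>

lemma q_bounded_S_omega_aux:
  fixes f :: "real^'n \<Rightarrow> complex" and I :: "'n set"
  assumes f: "f \<in> S_omega \<omega>" and I: "finite I" and m: "m > 0" and \<mu>: "\<mu> > 0"
  shows "\<exists>C. \<forall>is x. set is \<subseteq> I \<longrightarrow>
    exp (\<mu> * \<omega> (norm x)) * norm (iter_partial is f x) * W m (length is) \<le> C"
  using I m \<mu>
proof (induction I arbitrary: m \<mu> rule: finite_induct)
  case empty
  obtain C where C: "\<And>x. exp (\<mu> * \<omega> (norm x)) * norm (iter_partial [] f x) \<le> C"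
    using S_omega_decays(1)[OF f, of "[]"] empty unfolding decays_def by blast
  have "exp (\<mu> * \<omega> (norm x)) * norm (f x) * W m 0 \<le> C" for x
  proof -
    have "W m 0 \<le> 1" using young_weight_le[of 1 \<omega> m 0] at_one by simp
    then have "exp (\<mu> * \<omega> (norm x)) * norm (f x) * W m 0 \<le> exp (\<mu> * \<omega> (norm x)) * norm (f x) * 1"
      by (intro mult_left_mono) auto
    then show ?thesis using C[of x] unfolding iter_partial_Nil by linarith
  qed
  then show ?case by auto
next
  case (insert i I)
  \<comment> \<open>This change of parameter is reserved for the constant of the interpolation
    inequality.\<close>
  obtain m1 E where m1: "m1 \<ge> m" "E > 0" "\<And>k. 576 ^ k * W m k \<le> E * W m1 k"
    using young_weight_absorb_power[of \<omega> doubling_const m 576] doubling_const insert.prems(1) by auto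
  have m1': "2 * m1 > 0" "m1 > 0" using m1 insert.prems by auto
  obtain A where A: "\<And>is x. set is \<subseteq> I \<Longrightarrow> exp (2 * \<mu> * \<omega> (norm x)) * norm (iter_partial is f x) * W (2 * m1) (length is) \<le> A"
    using insert.IH[of "2 * m1" "2 * \<mu>"] m1' insert.prems by auto
  obtain B where B: "\<And>is x. exp (0 * \<omega> (norm x)) * norm (iter_partial is f x) * W (2 * m1) (length is) \<le> B"
    using q_bounded_zero_weight[OF f, of "2 * m1"] m1' unfolding q_bounded_def by auto
  have A0: "A \<ge> 0" by (rule order.trans[OF _ A[of "[]" 0]]) (simp_all add: young_weight_nonneg)
  have B0: "B \<ge> 0" by (rule order.trans[OF _ B[of 0 "[]"]]) (simp add: young_weight_nonneg)
  have "exp (\<mu> * \<omega> (norm x)) * norm (iter_partial is f x) * W m (length is) \<le> sqrt (4 * E\<^sup>2 * (A * B))"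
    if "is": "set is \<subseteq> insert i I" for "is" x
  proof (rule real_le_rsqrt)
    define k where "k = count_list is i"
    define js where "js = filter (\<lambda>j. j \<noteq> i) is"
    have mset: "mset is = mset (replicate k i @ js)"
      unfolding k_def js_def by (rule multiset_eqI) (auto simp: count_mset)
    have perm: "iter_partial is f = iter_partial (replicate k i @ js) f" by (rule S_omega_perm[OF f mset])
    have len: "length is = k + length js" using mset by (metis length_append length_replicate size_mset)
    have js: "set js \<subseteq> I" using "is" by (auto simp: js_def)
    define w1 w2 where "w1 = W (2 * m1) (length js)" and "w2 = W (2 * m1) (2 * k + length js)"
    define e where "e = exp (\<mu> * \<omega> (norm x))"
    have w0: "w1 \<ge> 0" "w2 \<ge> 0" unfolding w1_def w2_def by (rule young_weight_nonneg)+
    \<comment> \<open>The orders of the two interpolated derivatives, \<open>length js\<close> and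
      \<open>2 * k + length js\<close>, add up to twice the order of \<open>is\<close>.\<close>
    have "(W m1 (length is))\<^sup>2 = W (2 * m1) (length js + (2 * k + length js))"
      unfolding young_weight_double[symmetric] len by (simp add: algebra_simps)
    also have "\<dots> \<le> w1 * w2" unfolding w1_def w2_def using m1' by (intro young_weight_add nonneg) auto
    finally have w12: "(W m1 (length is))\<^sup>2 \<le> w1 * w2" .
    have "576 ^ (2 * k) * (W m (length is))\<^sup>2 \<le> (576 ^ length is * W m (length is))\<^sup>2"
    proof -
      have "(576::real) ^ (2 * k) \<le> 576 ^ (2 * length is)" by (rule power_increasing) (auto simp: len)
      then show ?thesis by (simp add: power_mult_distrib power_even_eq mult_right_mono)
    qed
    also have "\<dots> \<le> (E * W m1 (length is))\<^sup>2" by (intro power_mono m1 mult_nonneg_nonneg young_weight_nonneg) auto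
    also have "\<dots> \<le> E\<^sup>2 * (w1 * w2)" using w12 by (simp add: power_mult_distrib mult_left_mono)
    finally have W: "576 ^ (2 * k) * (W m (length is))\<^sup>2 \<le> E\<^sup>2 * (w1 * w2)" .
    show "(exp (\<mu> * \<omega> (norm x)) * norm (iter_partial is f x) * W m (length is))\<^sup>2 \<le> 4 * E\<^sup>2 * (A * B)"
    proof (cases "w1 = 0 \<or> w2 = 0")
      \<comment> \<open>A Young weight vanishes where the conjugate is infinite. Then A or B says
        nothing about the derivative, but the weight of \<open>is\<close> vanishes as well.\<close>
      case True
      then have "576 ^ (2 * k) * (W m (length is))\<^sup>2 \<le> 0" using W by auto
      moreover have "(576::real) ^ (2 * k) > 0" by simp
      ultimately have "(W m (length is))\<^sup>2 \<le> 0" by (simp add: mult_le_0_iff not_le)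
      then have "W m (length is) = 0" by simp
      then show ?thesis using A0 B0 by simp
    next
      case False
      then have w: "w1 > 0" "w2 > 0" using w0 by auto
      have e0: "e > 0" by (simp add: e_def)
      have A': "norm (iter_partial js f y) \<le> A / (e\<^sup>2 * w1)" if "norm x \<le> norm y" for y
      proof -
        have "e\<^sup>2 \<le> exp (2 * \<mu> * \<omega> (norm y))"
          using mono[OF _ that] insert.prems(2) unfolding e_def by (simp add: exp_double[symmetric])
        then have "e\<^sup>2 * norm (iter_partial js f y) * w1 \<le> exp (2 * \<mu> * \<omega> (norm y)) * norm (iter_partial js f y) * w1"
          using w by (intro mult_right_mono) auto
        also have "\<dots> \<le> A" unfolding w1_def by (rule A[OF js])
        finally show ?thesis using w e0 by (simp add: field_simps)
      qed
      have B': "norm (iter_partial (replicate (2 * k) i @ js) f y) \<le> B / w2" for y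
        using B[of y "replicate (2 * k) i @ js"] w unfolding w2_def by (simp add: field_simps)
      have "(norm (iter_partial is f x))\<^sup>2 \<le> 4 * 576 ^ (2 * k) * (A / (e\<^sup>2 * w1)) * (B / w2)"
        unfolding perm by (rule iter_partial_interpolation[OF S_omega_smooth[OF f]]) (use A' B' in auto)
      then have "(e * norm (iter_partial is f x) * W m (length is))\<^sup>2
          \<le> e\<^sup>2 * (4 * 576 ^ (2 * k) * (A / (e\<^sup>2 * w1)) * (B / w2)) * (W m (length is))\<^sup>2"
        unfolding power_mult_distrib by (intro mult_right_mono mult_left_mono) auto
      also have "\<dots> = 4 * (A * B) / (w1 * w2) * (576 ^ (2 * k) * (W m (length is))\<^sup>2)"
        using e0 w by (simp add: field_simps)
      also have "\<dots> \<le> 4 * (A * B) / (w1 * w2) * (E\<^sup>2 * (w1 * w2))"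
        using W A0 B0 w by (intro mult_left_mono) auto
      also have "\<dots> = 4 * E\<^sup>2 * (A * B)" using w by (simp add: field_simps)
      finally show ?thesis unfolding e_def .
    qed
  qed
  then show ?case by blast
qed

lemma q_bounded_S_omega:
  fixes f :: "real^'n \<Rightarrow> complex"
  assumes "f \<in> S_omega \<omega>" "m > 0" "\<mu> > 0"
  obtains C where "q_bounded m \<mu> f C"
  using q_bounded_S_omega_aux[OF assms(1) finite_class.finite_UNIV assms(2,3)]
  unfolding q_bounded_def by auto

section \<open>Joint continuity\<close>

lemma continuous_mult:
  "continuous_map (prod_topology (S_omega_topology \<omega>) (S_omega_topology \<omega>)) (S_omega_topology \<omega>)
    (\<lambda>(f, g). \<lambda>x :: real^'n. f x * g x)"
  (is "continuous_map ?T _ ?M")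
proof -
  have top: "topspace ?T = S_omega \<omega> \<times> S_omega \<omega>"
    by (simp add: topspace_S_omega_topology)
  have sub: "(\<lambda>x. a x - b x) \<in> S_omega \<omega>" if "a \<in> S_omega \<omega>" "b \<in> S_omega \<omega>" for a b :: "real^'n \<Rightarrow> complex"
    using S_omega_lincomb[OF that, of 1 "-1"] by simp
  show ?thesis
    \<comment> \<open>Continuity is tested on the generating balls only. The last unfolding restores
      the topology of the domain, which the first one has expanded too.\<close>
    unfolding S_omega_topology_def[of \<omega>, where ?'n = 'n]
    unfolding continuous_on_generated_topo_iff
    unfolding S_omega_topology_def[of \<omega>, where ?'n = 'n, symmetric]
  proof (intro conjI allI impI)
    show "?M ` topspace ?T \<subseteq> \<Union> {S_omega_ball \<omega> m n f r | m n f r. m \<ge> 1 \<and> n \<ge> 1 \<and> f \<in> S_omega \<omega> \<and> r > 0}"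
      using topspace_S_omega_topology[of \<omega>, where ?'a = 'n]
      unfolding top S_omega_topology_def topology_generated_by_topspace by (auto intro: S_omega_mult)
    fix U :: "(real^'n \<Rightarrow> complex) set" assume "U \<in> {S_omega_ball \<omega> m n f r | m n f r. m \<ge> 1 \<and> n \<ge> 1 \<and> f \<in> S_omega \<omega> \<and> r > 0}"
    then obtain m n and h :: "real^'n \<Rightarrow> complex" and r where
      U: "U = S_omega_ball \<omega> m n h r" and m: "m \<ge> 1" and n: "n \<ge> 1" and h: "h \<in> S_omega \<omega>" and r: "r > 0"
      by auto
    obtain m1 E where m1: "m1 \<ge> real m" "E > 0" "\<And>k. 2 ^ k * W (real m) k \<le> E * W m1 k"
      using young_weight_absorb_power[of \<omega> doubling_const "real m" 2] doubling_const m by auto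
    \<comment> \<open>The norms are indexed by natural numbers, so m1 is rounded up; the Young
      weight can only grow with the parameter.\<close>
    define m' where "m' = nat \<lceil>m1\<rceil>"
    have m': "m1 \<le> real m'" "m' \<ge> 1" using m1(1) m by (auto simp: m'_def le_nat_iff)
    have E: "2 ^ k * W (real m) k \<le> E * W (real m') k" for k
    proof -
      have "E * W m1 k \<le> E * W (real m') k"
        using m1 m' by (intro mult_left_mono young_weight_antimono_param nonneg) auto
      then show ?thesis using m1(3)[of k] by linarith
    qed
    show "openin ?T (?M -` U \<inter> topspace ?T)"
    proof (subst openin_subopen, intro ballI)
      fix p assume "p \<in> ?M -` U \<inter> topspace ?T"
      then obtain f g where p: "p = (f, g)" and f: "f \<in> S_omega \<omega>" and g: "g \<in> S_omega \<omega>"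
        and fg: "(\<lambda>x. f x * g x) \<in> U" unfolding top by auto
      define d where "d = (\<lambda>x. f x * g x - h x)"
      have d: "d \<in> S_omega \<omega>" unfolding d_def by (intro sub S_omega_mult f g h)
      have qd: "q_norm \<omega> m n d < ennreal r" using fg by (simp add: U S_omega_ball_def d_def)
      \<comment> \<open>The ball U is centred at h, not at the product of f and g. The norm of the
        difference d of the two is r0, so \<open>r - r0\<close> is the room left.\<close>
      define r0 where "r0 = enn2real (q_norm \<omega> m n d)"
      have fin: "q_norm \<omega> m n d < \<top>" using qd by (rule order.strict_trans) simp
      have r0: "q_norm \<omega> m n d = ennreal r0" "r0 \<ge> 0" using fin by (simp_all add: r0_def)
      have r0r: "r0 < r" using qd r0 r by (simp add: ennreal_less_iff)
      have bd: "q_bounded (real m) (real n) d r0" using q_bounded_of_q_norm[OF m d _ r0(2)] r0(1) by simp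
      have pos: "real m' > 0" "real n > 0" using m' n by auto
      obtain A where A: "q_bounded (real m') (real n) f A" using q_bounded_S_omega[OF f pos] .
      obtain B where B: "q_bounded (real m') (real n) g B" using q_bounded_S_omega[OF g pos] .
      have AB0: "A \<ge> 0" "B \<ge> 0" using q_bounded_nonneg[OF A] q_bounded_nonneg[OF B] .
      \<comment> \<open>The bound 1 reduces \<open>s * s\<close> to s, so the three error terms
        below add up to at most \<open>E * (1 + A + B) * s\<close>; the quotient makes this at most
        half of the room left.\<close>
      define s where "s = min 1 ((r - r0) / (2 * (E * (1 + A + B))))"
      have EAB: "E * (1 + A + B) > 0" using m1(2) AB0 by (intro mult_pos_pos) auto
      have s: "s > 0" "s \<le> 1" "E * (1 + A + B) * s \<le> (r - r0) / 2"
      proof -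
        show "s > 0" "s \<le> 1" using r0r EAB by (auto simp: s_def)
        have "E * (1 + A + B) * s \<le> E * (1 + A + B) * ((r - r0) / (2 * (E * (1 + A + B))))"
          using EAB by (intro mult_left_mono) (auto simp: s_def)
        also have "\<dots> = (r - r0) / 2" using EAB by (simp add: field_simps)
        finally show "E * (1 + A + B) * s \<le> (r - r0) / 2" .
      qed
      let ?V = "S_omega_ball \<omega> m' n f s \<times> S_omega_ball \<omega> m' n g s"
      have ball: "openin (S_omega_topology \<omega>) (S_omega_ball \<omega> m' n a s)" if "a \<in> S_omega \<omega>" for a :: "real^'n \<Rightarrow> complex"
        unfolding S_omega_topology_def by (rule topology_generated_by_Basis) (use that m' n s in auto)
      have "openin ?T ?V" unfolding openin_prod_Times_iff using ball f g by blast
      moreover have "p \<in> ?V" using f g s by (simp add: p S_omega_ball_def q_norm_zero)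
      moreover have "?V \<subseteq> ?M -` U \<inter> topspace ?T"
      proof
        fix p' assume "p' \<in> ?V"
        then obtain f' g' where p': "p' = (f', g')" and f': "f' \<in> S_omega \<omega>" and g': "g' \<in> S_omega \<omega>"
          and qf: "q_norm \<omega> m' n (\<lambda>x. f' x - f x) < ennreal s" and qg: "q_norm \<omega> m' n (\<lambda>x. g' x - g x) < ennreal s"
          by (auto simp: S_omega_ball_def)
        define u v where "u = (\<lambda>x. f' x - f x)" and "v = (\<lambda>x. g' x - g x)"
        have uv: "u \<in> S_omega \<omega>" "v \<in> S_omega \<omega>" unfolding u_def v_def by (intro sub f f' g g')+
        have bu: "q_bounded (real m') (real n) u s"
          using q_bounded_of_q_norm[OF m'(2) uv(1)] qf s(1) by (simp add: u_def less_imp_le)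
        have bv: "q_bounded (real m') (real n) v s"
          using q_bounded_of_q_norm[OF m'(2) uv(2)] qg s(1) by (simp add: v_def less_imp_le)
        note sm = S_omega_smooth[OF f] S_omega_smooth[OF g] S_omega_smooth[OF uv(1)] S_omega_smooth[OF uv(2)] S_omega_smooth[OF d]
        note mult = q_bounded_mult[where m="real m" and m'="real m'" and \<mu>="real n" and E=E, OF _ _ _ _ E m1(2)]
        \<comment> \<open>Expansion of the product of \<open>f + u\<close> and \<open>g + v\<close>;
          besides d there remain one quadratic and two linear error terms.\<close>
        have "q_bounded (real m) (real n) (\<lambda>x. d x + (u x * v x + (f x * v x + u x * g x)))
            (r0 + (E * (s * s) + (E * (A * s) + E * (s * B))))"
          using m by (intro q_bounded_add smooth_mult bd mult bu bv A B sm
              smooth_lincomb[where a=1 and b=1, simplified]) auto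
        moreover have "(\<lambda>x. d x + (u x * v x + (f x * v x + u x * g x))) = (\<lambda>x. f' x * g' x - h x)"
          by (simp add: d_def u_def v_def fun_eq_iff algebra_simps)
        ultimately have "q_norm \<omega> m n (\<lambda>x. f' x * g' x - h x) \<le> ennreal (r0 + (E * (s * s) + (E * (A * s) + E * (s * B))))"
          using q_norm_le[OF m] by simp
        also have "\<dots> < ennreal r"
        proof -
          have "E * (s * s) \<le> E * (s * 1)" using s m1(2) by (intro mult_left_mono) auto
          then have "r0 + (E * (s * s) + (E * (A * s) + E * (s * B))) \<le> r0 + E * (1 + A + B) * s"
            by (simp add: algebra_simps)
          also have "\<dots> < r" using s(3) r0r by simp
          finally show ?thesis using r by (simp add: ennreal_less_iff ennreal_lessI)
        qed
        finally show "p' \<in> ?M -` U \<inter> topspace ?T"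
          unfolding top using f' g' by (auto simp: p' U S_omega_ball_def S_omega_mult)
      qed
      ultimately show "\<exists>V. openin ?T V \<and> p \<in> V \<and> V \<subseteq> ?M -` U \<inter> topspace ?T" by blast
    qed
  qed
qed

end

theorem theorem3p3:
  fixes \<omega> :: "real \<Rightarrow> real"
  assumes "nonquasianalytic_weight \<omega>" and "normalized_weight \<omega>"
  shows "(\<forall>f \<in> S_omega \<omega>. \<forall>g \<in> S_omega \<omega>. (\<lambda>x :: real^'n. f x * g x) \<in> S_omega \<omega>) \<and>
    continuous_map
      (prod_topology (S_omega_topology \<omega>) (S_omega_topology \<omega>))
      (S_omega_topology \<omega>)
      (\<lambda>(f, g). \<lambda>x :: real^'n. f x * g x)"
proof -
  interpret weight \<omega> by unfold_locales (fact assms)+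
  show ?thesis using S_omega_mult continuous_mult by blast
qed

end
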